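(* Let $n\geq3$, let $f:(\mathbb K^{n-2},S)\to(\mathbb K^{n-2},0)$ be a finitely determined (multi)germ of minimal corank, let $F(x,\lambda)=(f_\lambda(x),\lambda)$, $\lambda\in\mathbb K^2$, be a 2-parameter stable unfolding of $f$, and let $g=\{g_1,g_2\}$ with $$g_1(x_1,\ldots,x_{n-2},y,z)=(x_1,\ldots,x_{n-2},y,z^2),\qquad g_2(x_1,\ldots,x_{n-2},y,z)=(x_1,\ldots,x_{n-2},y,z^2+y),$$ so that $\{F,g\}$ is the double fold concatenation of $f$. Then $$\mathcal A_e\text{-}\mathrm{cod}(\{F,g\})=\mathcal A_e\text{-}\mathrm{cod}(\{F,g_1\})+\dim_{\mathbb K}\frac{\mathcal O_{n-1}}{\{\xi:\ \xi=-\eta_{n-1}(x,y,y)+\eta_n(x,y,y)\}},$$ where $\mathcal O_{n-1}$ is the ring of function germs in the variables $(x,y)=(x_1,\ldots,x_{n-2},y)$ and $(\eta_{n-1},\eta_n)$ ranges over the last two components of the vector fields $\eta=(\eta_1,\ldots,\eta_n)\in\mathrm{Lift}(\{F,g_1\})$.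
   Context: $\mathbb K=\mathbb C$ or $\mathbb R$. A multigerm $f:(\mathbb K^n,S)\to(\mathbb K^p,0)$ is the germ along a finite set $S$ of an analytic (if $\mathbb K=\mathbb C$) or smooth (if $\mathbb K=\mathbb R$) map; $\{F,g\}$ is the multigerm whose branches are those of $F$ together with those of $g$. $\theta_n,\theta_p$ are germs of vector fields on source and target, $\theta(f)$ germs of vector fields along $f$, and $\mathcal A_e\text{-}\mathrm{cod}(f)=\dim_{\mathbb K}\theta(f)/(\{df\circ\xi:\xi\in\theta_n\}+\{\eta\circ f:\eta\in\theta_p\})$; $f$ is stable if this is $0$. $\mathrm{Lift}(f)=\{\eta\in\theta_p:\exists\,\xi\in\theta_n,\ df\circ\xi=\eta\circ f\}$, where for a multigerm $\xi$ is a germ of vector field along $S$. Minimal corank: every branch has differential of rank at least the minimum of source and target dimensions minus 1. Finitely determined means finitely $\mathcal A$-determined. A 2-parameter stable unfolding of $f$ is $F(x,\lambda)=(f_\lambda(x),\lambda)$, $\lambda\in\mathbb K^2$, $f_0=f$, with $F:(\mathbb K^n,S\times\{0\})\to(\mathbb K^n,0)$ stable. *)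

theory Defs
  imports "HOL-Analysis.Analysis" "HOL-Library.Function_Algebras" "HOL-Library.Extended_Nat"
begin

text \<open>
  The ground field is a type \<open>'k\<close> of sort \<open>real_normed_field\<close>; the main statement uses
  \<open>{real_normed_field, euclidean_space}\<close>, whose members are, up to isometric isomorphism,
  exactly the real and the complex numbers (the norm of a \<open>real_normed_field\<close> is multiplicative).

  Germs are handled through total representatives. Only their values near the base point matter,
  and every space of germs below is used modulo a subspace that contains all representatives of
  the zero germ.
\<close>


subsection \<open>Smooth (real case) and analytic (complex case) germs\<close>

definition partial :: "'i \<Rightarrow> ('k::real_normed_field ^ 'i \<Rightarrow> 'k) \<Rightarrow> 'k ^ 'i \<Rightarrow> 'k" where
  "partial i h x = frechet_derivative h (at x) (axis i 1)"

primrec iter_partial ::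
  "'i list \<Rightarrow> ('k::real_normed_field ^ 'i \<Rightarrow> 'k) \<Rightarrow> 'k ^ 'i \<Rightarrow> 'k" where
  "iter_partial [] h = h"
| "iter_partial (i # is) h = partial i (iter_partial is h)"

text \<open>
  All iterated partial derivatives exist near \<open>p\<close> and are Frechet differentiable with a
  \<open>'k\<close>-linear derivative. Over the reals this is \<open>C\<^sup>\<infinity>\<close>; over the complex numbers it is complex
  differentiability in a neighbourhood (as in \<^const>\<open>analytic_on\<close>), that is, analyticity.
\<close>
definition germ_fun :: "'k::real_normed_field ^ 'i \<Rightarrow> ('k ^ 'i \<Rightarrow> 'k) \<Rightarrow> bool" where
  "germ_fun p h \<longleftrightarrow> (\<exists>U. open U \<and> p \<in> U \<and> (\<forall>is. \<forall>x\<in>U.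
     (iter_partial is h has_derivative
        (\<lambda>v. \<Sum>i\<in>UNIV. partial i (iter_partial is h) x * v $ i)) (at x)))"

definition germ_map :: "'k::real_normed_field ^ 'i \<Rightarrow> ('k ^ 'i \<Rightarrow> 'k ^ 'j) \<Rightarrow> bool" where
  "germ_map p f \<longleftrightarrow> (\<forall>j. germ_fun p (\<lambda>x. f x $ j))"

definition diffeo_germ ::
  "'k::real_normed_field ^ 'i \<Rightarrow> 'k ^ 'i \<Rightarrow> ('k ^ 'i \<Rightarrow> 'k ^ 'i) \<Rightarrow> bool" where
  "diffeo_germ p q \<phi> \<longleftrightarrow> germ_map p \<phi> \<and> \<phi> p = q \<and>
     (\<exists>\<psi>. germ_map q \<psi> \<and> \<psi> q = p \<and>
        (\<forall>\<^sub>F x in nhds p. \<psi> (\<phi> x) = x) \<and> (\<forall>\<^sub>F y in nhds q. \<phi> (\<psi> y) = y))"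

definition same_jet ::
  "nat \<Rightarrow> 'k::real_normed_field ^ 'i \<Rightarrow> ('k ^ 'i \<Rightarrow> 'k ^ 'j) \<Rightarrow> ('k ^ 'i \<Rightarrow> 'k ^ 'j) \<Rightarrow> bool" where
  "same_jet k p f g \<longleftrightarrow> (\<forall>is j. length is \<le> k \<longrightarrow>
     iter_partial is (\<lambda>x. f x $ j) p = iter_partial is (\<lambda>x. g x $ j) p)"


subsection \<open>Multigerms\<close>

text \<open>
  A multigerm is the list of its branches, each given by its base point and a representative.
  Every branch lives on its own copy of the source space, so that the concatenation of two
  multigerms is \<open>@\<close> even if base points coincide. A germ along a finite subset \<open>S\<close> of one
  copy of the source space is a multigerm with pairwise distinct base points,
  \<open>S\<close> being the set of these points.
\<close>
type_synonym ('a, 'b) multigerm = "('a \<times> ('a \<Rightarrow> 'b)) list"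

definition multigerm :: "('k::real_normed_field ^ 'a, 'k ^ 'b) multigerm \<Rightarrow> bool" where
  "multigerm fs \<longleftrightarrow> (\<forall>(p, f)\<in>set fs. germ_map p f \<and> f p = 0)"

text \<open>
  Families of vector-valued germs, one at each base point: for \<open>'c = 'b\<close> these are the vector
  fields along the multigerm, for \<open>'c = 'a\<close> the vector fields on its source. Values at indices
  beyond the number of branches are irrelevant.
\<close>
definition fields_along ::
  "('k::real_normed_field ^ 'a, 'k ^ 'b) multigerm \<Rightarrow> (nat \<Rightarrow> 'k ^ 'a \<Rightarrow> 'k ^ 'c) set" where
  "fields_along fs = {v. \<forall>i<length fs. germ_map (fst (fs ! i)) (v i)}"

definition Ae_tangent ::
  "('k::real_normed_field ^ 'a, 'k ^ 'b) multigerm \<Rightarrow> (nat \<Rightarrow> 'k ^ 'a \<Rightarrow> 'k ^ 'b) set" where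
  "Ae_tangent fs = {v \<in> fields_along fs. \<exists>\<xi>\<in>fields_along fs. \<exists>\<eta>. germ_map 0 \<eta> \<and>
     (\<forall>i<length fs. case fs ! i of (p, f) \<Rightarrow>
        \<forall>\<^sub>F x in nhds p. v i x = frechet_derivative f (at x) (\<xi> i x) + \<eta> (f x))}"

definition Lift ::
  "('k::real_normed_field ^ 'a, 'k ^ 'b) multigerm \<Rightarrow> ('k ^ 'b \<Rightarrow> 'k ^ 'b) set" where
  "Lift fs = {\<eta>. germ_map 0 \<eta> \<and> (\<exists>\<xi>\<in>fields_along fs.
     \<forall>i<length fs. case fs ! i of (p, f) \<Rightarrow>
        \<forall>\<^sub>F x in nhds p. frechet_derivative f (at x) (\<xi> i x) = \<eta> (f x))}"


subsection \<open>Dimension of a quotient space\<close>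

text \<open>\<open>B\<close> maps bijectively onto a finite basis of \<open>V / T\<close>.\<close>
definition basis_mod ::
  "('k::field \<Rightarrow> 'v \<Rightarrow> 'v::ab_group_add) \<Rightarrow> 'v set \<Rightarrow> 'v set \<Rightarrow> 'v set \<Rightarrow> bool" where
  "basis_mod smul V T B \<longleftrightarrow> finite B \<and> B \<subseteq> V \<and>
     (\<forall>c. (\<Sum>b\<in>B. smul (c b) b) \<in> T \<longrightarrow> (\<forall>b\<in>B. c b = 0)) \<and>
     (\<forall>v\<in>V. \<exists>c. v - (\<Sum>b\<in>B. smul (c b) b) \<in> T)"

definition quot_dim ::
  "('k::field \<Rightarrow> 'v \<Rightarrow> 'v::ab_group_add) \<Rightarrow> 'v set \<Rightarrow> 'v set \<Rightarrow> enat" where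
  "quot_dim smul V T =
     (if \<exists>B. basis_mod smul V T B then enat (card (SOME B. basis_mod smul V T B)) else \<infinity>)"

definition Ae_cod :: "('k::real_normed_field ^ 'a, 'k ^ 'b) multigerm \<Rightarrow> enat" where
  "Ae_cod fs = quot_dim (\<lambda>c v i x. c *s v i x) (fields_along fs) (Ae_tangent fs)"

definition stable_multigerm :: "('k::real_normed_field ^ 'a, 'k ^ 'b) multigerm \<Rightarrow> bool" where
  "stable_multigerm fs \<longleftrightarrow> Ae_cod fs = 0"


subsection \<open>Finite determinacy and minimal corank\<close>

text \<open>The source diffeomorphism may permute the base points, whence \<open>\<sigma>\<close>.\<close>
definition A_equivalent ::
  "('k::real_normed_field ^ 'a, 'k ^ 'b) multigerm \<Rightarrow> ('k ^ 'a, 'k ^ 'b) multigerm \<Rightarrow> bool" where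
  "A_equivalent fs gs \<longleftrightarrow>
     (\<exists>\<sigma> \<phi> \<psi>. bij_betw \<sigma> {..<length fs} {..<length gs} \<and> diffeo_germ 0 0 \<psi> \<and>
        (\<forall>i<length fs. case (fs ! i, gs ! \<sigma> i) of ((p, f), (q, g)) \<Rightarrow>
           diffeo_germ p q (\<phi> i) \<and> (\<forall>\<^sub>F x in nhds p. g (\<phi> i x) = \<psi> (f x))))"

definition finitely_determined :: "('k::real_normed_field ^ 'a, 'k ^ 'b) multigerm \<Rightarrow> bool" where
  "finitely_determined fs \<longleftrightarrow>
     (\<exists>k. \<forall>gs. multigerm gs \<and> list_all2 (\<lambda>(p, f) (q, g). q = p \<and> same_jet k p f g) fs gs
        \<longrightarrow> A_equivalent fs gs)"

definition minimal_corank :: "('k::real_normed_field ^ 'a, 'k ^ 'b) multigerm \<Rightarrow> bool" where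
  "minimal_corank fs \<longleftrightarrow>
     (\<forall>(p, f)\<in>set fs. vec.dim (range (frechet_derivative f (at p))) \<ge> min CARD('a) CARD('b) - 1)"


subsection \<open>Unfoldings and the double fold\<close>

definition join :: "'k ^ 'a \<Rightarrow> 'k ^ 'd \<Rightarrow> 'k ^ ('a::finite + 'd::finite)" where
  "join x l = (\<chi> i. case i of Inl a \<Rightarrow> x $ a | Inr d \<Rightarrow> l $ d)"

text \<open>\<open>F(x,\<lambda>) = (f\<^sub>\<lambda>(x), \<lambda>)\<close> branch by branch, with parameter space \<open>'k ^ 'd\<close>.\<close>
definition is_unfolding ::
  "('k::real_normed_field ^ 'a, 'k ^ 'b) multigerm
    \<Rightarrow> ('k ^ ('a + 'd::finite), 'k ^ ('b + 'd)) multigerm \<Rightarrow> bool" where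
  "is_unfolding f F \<longleftrightarrow> multigerm F \<and>
     list_all2 (\<lambda>(p, h) (q, H). q = join p 0 \<and>
       (\<exists>\<phi>. (\<forall>\<^sub>F (x, l) in nhds (p, 0). H (join x l) = join (\<phi> l x) l) \<and>
            (\<forall>\<^sub>F x in nhds p. \<phi> 0 x = h x))) f F"

text \<open>
  In \<open>'k ^ ('m + 2)\<close> the coordinates \<open>x\<close>, \<open>y\<close>, \<open>z\<close> have the indices \<open>Inl a\<close>, \<open>Inr 1\<close>, \<open>Inr 2\<close>.
\<close>
definition fold1 :: "'k::real_normed_field ^ ('m::finite + 2) \<Rightarrow> 'k ^ ('m + 2)" where
  "fold1 w = (\<chi> i. if i = Inr 2 then (w $ Inr 2)\<^sup>2 else w $ i)"

definition fold2 :: "'k::real_normed_field ^ ('m::finite + 2) \<Rightarrow> 'k ^ ('m + 2)" where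
  "fold2 w = (\<chi> i. if i = Inr 2 then (w $ Inr 2)\<^sup>2 + w $ Inr 1 else w $ i)"

text \<open>\<open>(x, y) \<mapsto> (x, y, y)\<close>\<close>
definition diag :: "'k ^ ('m::finite + 1) \<Rightarrow> 'k ^ ('m + 2)" where
  "diag u = (\<chi> i. case i of Inl a \<Rightarrow> u $ Inl a | Inr _ \<Rightarrow> u $ Inr 1)"

end

theory Submission
  imports Defs
begin

text \<open>
  Put \<open>G = {F, g\<^sub>1}\<close>. Forgetting the branch \<open>g\<^sub>2\<close> maps the normal space of \<open>{G, g\<^sub>2}\<close> onto that of
  \<open>G\<close>, and the kernel is \<open>\<theta>(g\<^sub>2)\<close> modulo \<open>tg\<^sub>2(\<theta>\<^sub>n)\<close> and the fields \<open>\<eta> \<circ> g\<^sub>2\<close> with \<open>\<eta>\<close>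
  liftable over \<open>G\<close>. Since \<open>dg\<^sub>2(\<xi>) = (\<xi>\<^sub>x, \<xi>\<^sub>y, 2z \<xi>\<^sub>z + \<xi>\<^sub>y)\<close>, Hadamard's lemma shows that
  \<open>v \<mapsto> v\<^sub>n(x,y,0) - v\<^sub>n\<^sub>-\<^sub>1(x,y,0)\<close> identifies \<open>\<theta>(g\<^sub>2) / tg\<^sub>2(\<theta>\<^sub>n)\<close> with \<open>\<O>\<^sub>n\<^sub>-\<^sub>1\<close>; it sends \<open>\<eta> \<circ> g\<^sub>2\<close>
  to \<open>\<eta>\<^sub>n(x,y,y) - \<eta>\<^sub>n\<^sub>-\<^sub>1(x,y,y)\<close>.
\<close>


subsection \<open>Dimensions of quotient spaces\<close>

text \<open>A field in the kernel is tangent to \<open>G\<close> through some \<eta>, and what it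
  contributes on the branch g_2 can be read off only after \<eta> \<circ> g_2 has been subtracted.
  This \<eta> is determined only up to Lift(G), so a linear map out of the kernel would need a
  choice. The isomorphism is therefore built in the other direction: a function h in O_{n-1} goes to
  the field that is h in the z-direction on g_2 and zero on \<open>G\<close>, and surjectivity is
  asked for only modulo the tangent space. The ambiguity of \<eta> is exactly what produces the
  denominator of the last summand. The codimensions may be infinite, so dimensions are added in
  \<open>enat\<close>. The real and the complex case share one argument: the Hadamard quotient is an
  integral over a real parameter in [0,1], and its smoothness follows by coinduction on iterated
  partial derivatives.\<close>

text \<open>
  A locale of its own, since everything proved in \<^locale>\<open>vector_space\<close> itself is also
  interpreted, without a qualifier, for \<open>scaleR\<close>.
\<close>
locale vector_space_mod = vector_space scale
  for scale :: "'a::field \<Rightarrow> 'b::ab_group_add \<Rightarrow> 'b"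
begin

text \<open>\<open>A\<close> consists of representatives in \<open>V\<close>, not of classes.
  Distinct elements of \<open>A\<close> are automatically distinct modulo \<open>T\<close>, so
  \<open>card A\<close> counts independent classes.\<close>

definition indep_mod :: "'b set \<Rightarrow> 'b set \<Rightarrow> 'b set \<Rightarrow> bool" where
  "indep_mod V T A \<longleftrightarrow> finite A \<and> A \<subseteq> V \<and>
     (\<forall>c. (\<Sum>a\<in>A. scale (c a) a) \<in> T \<longrightarrow> (\<forall>a\<in>A. c a = 0))"

lemma indep_modD:
  "indep_mod V T A \<Longrightarrow> (\<Sum>a\<in>A. scale (c a) a) \<in> T \<Longrightarrow> a \<in> A \<Longrightarrow> c a = 0"
  unfolding indep_mod_def by blast

lemma basis_mod_iff:
  "basis_mod scale V T B \<longleftrightarrow>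
     indep_mod V T B \<and> (\<forall>v\<in>V. \<exists>c. v - (\<Sum>b\<in>B. scale (c b) b) \<in> T)"
  unfolding basis_mod_def indep_mod_def by (simp only: conj_assoc)

lemma indep_mod_mono:
  assumes "indep_mod K T' A" "K \<subseteq> V" "T \<subseteq> T'" shows "indep_mod V T A"
  unfolding indep_mod_def
proof (intro conjI allI impI)
  fix c assume "(\<Sum>a\<in>A. scale (c a) a) \<in> T"
  with assms(3) have "(\<Sum>a\<in>A. scale (c a) a) \<in> T'" by (rule subsetD)
  from indep_modD[OF assms(1) this] show "\<forall>a\<in>A. c a = 0" by (intro ballI)
qed (use assms in \<open>auto simp: indep_mod_def\<close>)

text \<open>Expressing each element of \<open>A\<close> modulo \<open>T\<close> through
  \<open>B\<close> gives a matrix \<open>M\<close>. A linear relation between its rows is a relation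
  between the elements of \<open>A\<close> modulo \<open>T\<close>, so the rows are independent;
  they lie in the span of at most \<open>card B\<close> unit vectors.\<close>

lemma card_indep_mod_le:
  assumes T: "subspace T" and B: "basis_mod scale V T B" and A: "indep_mod V T A"
  shows "card A \<le> card B"
proof -
  interpret F: vector_space "\<lambda>(c::'a) (f::'b \<Rightarrow> 'a) b. c * f b"
    by unfold_locales (auto simp: fun_eq_iff algebra_simps)
  have fin: "finite A" "finite B" and "A \<subseteq> V"
    using A B unfolding indep_mod_def basis_mod_def by auto
  then have "\<forall>a\<in>A. \<exists>c. a - (\<Sum>b\<in>B. scale (c b) b) \<in> T"
    using B unfolding basis_mod_iff by blast
  then obtain M where M: "\<And>a. a \<in> A \<Longrightarrow> a - (\<Sum>b\<in>B. scale (M a b) b) \<in> T"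
    by metis
  have ind: "\<forall>a\<in>A. c a = 0" if c: "\<And>b. b \<in> B \<Longrightarrow> (\<Sum>a\<in>A. c a * M a b) = 0" for c
  proof -
    have "(\<Sum>a\<in>A. scale (c a) (\<Sum>b\<in>B. scale (M a b) b))
        = (\<Sum>b\<in>B. scale (\<Sum>a\<in>A. c a * M a b) b)"
      by (simp add: scale_sum_right scale_sum_left sum.swap[of _ B A])
    also have "\<dots> = 0" using c by simp
    finally have "(\<Sum>a\<in>A. scale (c a) a)
        = (\<Sum>a\<in>A. scale (c a) (a - (\<Sum>b\<in>B. scale (M a b) b)))"
      by (simp add: scale_right_diff_distrib sum_subtractf)
    also have "\<dots> \<in> T"
      using M by (intro subspace_sum[OF T] subspace_scale[OF T])
    finally show ?thesis using indep_modD[OF A] by blast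
  qed
  \<comment> \<open>Rows are cut off to 0 outside \<open>B\<close>, so that they lie in the span of
    the unit vectors \<open>e b\<close> with \<open>b \<in> B\<close>.\<close>
  define r where "r a = (\<lambda>b. if b \<in> B then M a b else 0)" for a
  define e where "e b = (\<lambda>b'. if b' = b then 1 else 0 :: 'a)" for b :: 'b
  have inj: "inj_on r A"
  proof (rule inj_onI, rule ccontr)
    fix a a' assume a: "a \<in> A" "a' \<in> A" "r a = r a'" "a \<noteq> a'"
    \<comment> \<open>Two equal rows would satisfy a relation with coefficients 1 and -1.\<close>
    have "(\<Sum>x\<in>A. (if x = a then 1 else if x = a' then - 1 else 0) * M x b) = 0" if "b \<in> B" for b
    proof -
      have "(\<Sum>x\<in>A. (if x = a then 1 else if x = a' then - 1 else 0) * M x b)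
          = (\<Sum>x\<in>A. (if x = a then M x b else 0) - (if x = a' then M x b else 0))"
        by (rule sum.cong) (use a in auto)
      also have "\<dots> = M a b - M a' b"
        using a fin by (simp add: sum_subtractf)
      also have "\<dots> = 0"
        using fun_cong[OF a(3), of b] that by (simp add: r_def)
      finally show ?thesis .
    qed
    from ind[OF this] a(1) show False by auto
  qed
  have sum_app: "(\<Sum>f\<in>S. (\<lambda>b. c f * f b)) x = (\<Sum>f\<in>S. c f * f x)"
    for S c and x :: 'b
    by (induction S rule: infinite_finite_induct) auto
  have "F.independent (r ` A)"
  proof (rule F.independent_if_scalars_zero)
    show "finite (r ` A)" using fin by simp
    fix c x assume 0: "(\<Sum>f\<in>r ` A. (\<lambda>b. c f * f b)) = 0" and "x \<in> r ` A"
    then obtain a where a: "a \<in> A" "x = r a" by auto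
    have "(\<Sum>a\<in>A. c (r a) * M a b) = 0" if "b \<in> B" for b
    proof -
      have "(\<Sum>f\<in>r ` A. c f * f b) = 0"
        using fun_cong[OF 0, of b] unfolding sum_app by simp
      then show ?thesis
        using that unfolding sum.reindex[OF inj] by (simp add: r_def)
    qed
    from ind[OF this] a show "c x = 0" by auto
  qed
  moreover have "r a \<in> F.span (e ` B)" for a
  proof -
    have sum_app2: "(\<Sum>f\<in>S. (\<lambda>b. c f * e f b)) x = (\<Sum>f\<in>S. c f * e f x)"
      for S and c :: "'b \<Rightarrow> 'a" and x :: 'b
      by (induction S rule: infinite_finite_induct) auto
    have "r a = (\<Sum>b\<in>B. (\<lambda>x. M a b * e b x))"
      unfolding fun_eq_iff sum_app2 using fin
      by (auto simp: r_def e_def if_distrib[of "(*) _"] cong: if_cong)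
    also have "\<dots> \<in> F.span (e ` B)"
      by (intro F.span_sum F.span_scale F.span_base) auto
    finally show ?thesis .
  qed
  ultimately have "card (r ` A) \<le> card (e ` B)"
    using F.independent_span_bound[of "e ` B" "r ` A"] fin by blast
  also have "card (e ` B) \<le> card B" using fin by (simp add: card_image_le)
  finally show ?thesis by (simp add: card_image[OF inj])
qed

text \<open>The choice of a basis by \<open>SOME\<close> is harmless: each of two bases is
  independent, so the cardinality bound applies in both directions.\<close>

lemma quot_dim_eqI:
  assumes "subspace T" "basis_mod scale V T B"
  shows "quot_dim scale V T = enat (card B)"
proof -
  have "basis_mod scale V T (SOME B. basis_mod scale V T B)"
    using assms(2) by (rule someI)
  then have "card (SOME B. basis_mod scale V T B) = card B"
    using card_indep_mod_le[OF assms(1)] assms(2) basis_mod_iff by (meson order_antisym)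
  then show ?thesis using assms(2) unfolding quot_dim_def by auto
qed

lemma quot_dim_infinity:
  "\<nexists>B. basis_mod scale V T B \<Longrightarrow> quot_dim scale V T = \<infinity>"
  unfolding quot_dim_def by simp

section \<open>Existence of bases and additivity of the dimension\<close>

lemma indep_mod_insert:
  assumes T: "subspace T" and A: "indep_mod V T A" and v: "v \<in> V"
    and no: "\<nexists>c. v - (\<Sum>a\<in>A. scale (c a) a) \<in> T"
  shows "v \<notin> A" "indep_mod V T (insert v A)"
proof -
  have fin: "finite A" using A unfolding indep_mod_def by simp
  show v': "v \<notin> A"
  proof
    assume "v \<in> A"
    then have "(\<Sum>a\<in>A. scale (if a = v then 1 else 0) a) = v"
      using fin by (simp add: if_distrib[of "\<lambda>c. scale c _"] cong: if_cong)
    then have "v - (\<Sum>a\<in>A. scale (if a = v then 1 else 0) a) \<in> T"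
      using subspace_0[OF T] by simp
    then have "\<exists>c. v - (\<Sum>a\<in>A. scale (c a) a) \<in> T"
      by (rule exI[where x = "\<lambda>a. if a = v then 1 else 0"])
    with no show False by contradiction
  qed
  show "indep_mod V T (insert v A)"
    unfolding indep_mod_def
  proof (intro conjI allI impI)
    fix c assume "(\<Sum>a\<in>insert v A. scale (c a) a) \<in> T"
    then have c: "scale (c v) v + (\<Sum>a\<in>A. scale (c a) a) \<in> T"
      using fin v' by simp
    have "c v = 0"
    proof (rule ccontr)
      assume nz: "c v \<noteq> 0"
      have "scale (inverse (c v)) (scale (c v) v + (\<Sum>a\<in>A. scale (c a) a)) \<in> T"
        using c by (rule subspace_scale[OF T])
      moreover have "scale (inverse (c v)) (scale (c v) v + (\<Sum>a\<in>A. scale (c a) a))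
          = v - (\<Sum>a\<in>A. scale (- inverse (c v) * c a) a)"
        using nz by (simp add: scale_right_distrib scale_sum_right sum_negf)
      ultimately have "v - (\<Sum>a\<in>A. scale (- inverse (c v) * c a) a) \<in> T" by metis
      with no show False by (metis (no_types))
    qed
    with c indep_modD[OF A] show "\<forall>a\<in>insert v A. c a = 0" by simp
  qed (use A v in \<open>auto simp: indep_mod_def\<close>)
qed

text \<open>The bound provides an independent set of greatest cardinality; a vector that it does not
  generate modulo \<open>T\<close> could be added to it.\<close>

lemma basis_mod_exists:
  assumes T: "subspace T" and bd: "\<And>A. indep_mod V T A \<Longrightarrow> card A \<le> n"
  shows "\<exists>B. basis_mod scale V T B"
proof -
  have "indep_mod V T {}" by (simp add: indep_mod_def)
  from ex_has_greatest_nat[of "indep_mod V T" _ card, OF this, of "Suc n"]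
  obtain B where B: "indep_mod V T B" and mx: "\<And>A. indep_mod V T A \<Longrightarrow> card A \<le> card B"
    using bd by (metis less_Suc_eq_le)
  have "\<exists>c. v - (\<Sum>b\<in>B. scale (c b) b) \<in> T" if "v \<in> V" for v
  proof (rule ccontr)
    assume no: "\<nexists>c. v - (\<Sum>b\<in>B. scale (c b) b) \<in> T"
    have "finite B" using B unfolding indep_mod_def by simp
    with mx[OF indep_mod_insert(2)[OF T B that no]] indep_mod_insert(1)[OF T B that no]
    show False by simp
  qed
  with B show ?thesis unfolding basis_mod_iff by blast
qed

text \<open>Expand first modulo \<open>K\<close>; the remainder lies in \<open>K\<close> and is
  expanded modulo \<open>T\<close>. The bases are disjoint because \<open>B2\<close> lies in
  \<open>K\<close>, where no element of \<open>B1\<close> can lie.\<close>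

lemma basis_mod_union:
  assumes sub: "subspace T" "subspace K" and le: "T \<subseteq> K" "K \<subseteq> V"
    and B1: "basis_mod scale V K B1" and B2: "basis_mod scale K T B2"
  shows "B1 \<inter> B2 = {}" "basis_mod scale V T (B1 \<union> B2)"
proof -
  have fin: "finite B1" "finite B2" and in_V: "B1 \<subseteq> V" and in_K: "B2 \<subseteq> K"
    using B1 B2 unfolding basis_mod_def by auto
  have sum_K: "(\<Sum>b\<in>B2. scale (c b) b) \<in> K" for c
    using in_K by (intro subspace_sum[OF sub(2)] subspace_scale[OF sub(2)]) auto
  show disj: "B1 \<inter> B2 = {}"
  proof (rule ccontr)
    assume "B1 \<inter> B2 \<noteq> {}"
    then obtain b where b: "b \<in> B1" "b \<in> B2" by auto
    have "(\<Sum>a\<in>B1. scale (if a = b then 1 else 0) a) = b"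
      using fin b by (simp add: if_distrib[of "\<lambda>c. scale c _"] cong: if_cong)
    with b in_K indep_modD[of V K B1 "\<lambda>a. if a = b then 1 else 0" b] B1 show False
      unfolding basis_mod_iff by auto
  qed
  have split: "(\<Sum>b\<in>B1 \<union> B2. scale (c b) b)
      = (\<Sum>b\<in>B1. scale (c b) b) + (\<Sum>b\<in>B2. scale (c b) b)" for c
    using fin disj by (rule sum.union_disjoint)
  show "basis_mod scale V T (B1 \<union> B2)"
    unfolding basis_mod_def
  proof (intro conjI allI impI ballI)
    fix c b assume T: "(\<Sum>b\<in>B1 \<union> B2. scale (c b) b) \<in> T"
    then have "(\<Sum>b\<in>B1 \<union> B2. scale (c b) b) - (\<Sum>b\<in>B2. scale (c b) b) \<in> K"
      using le sum_K by (intro subspace_diff[OF sub(2)]) auto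
    then have "(\<Sum>b\<in>B1. scale (c b) b) \<in> K" unfolding split by simp
    then have c1: "\<forall>b\<in>B1. c b = 0"
      using B1 indep_modD unfolding basis_mod_iff by blast
    with T have "(\<Sum>b\<in>B2. scale (c b) b) \<in> T" unfolding split by simp
    then have c2: "\<forall>b\<in>B2. c b = 0"
      using B2 indep_modD unfolding basis_mod_iff by blast
    assume "b \<in> B1 \<union> B2"
    with c1 c2 show "c b = 0" by auto
  next
    fix v assume "v \<in> V"
    then obtain c1 where "v - (\<Sum>b\<in>B1. scale (c1 b) b) \<in> K"
      using B1 unfolding basis_mod_def by blast
    then obtain c2 where c2: "v - (\<Sum>b\<in>B1. scale (c1 b) b) - (\<Sum>b\<in>B2. scale (c2 b) b) \<in> T"
      using B2 unfolding basis_mod_def by blast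
    define c where "c b = (if b \<in> B1 then c1 b else c2 b)" for b
    have "(\<Sum>b\<in>B1. scale (c b) b) = (\<Sum>b\<in>B1. scale (c1 b) b)"
      by (simp add: c_def)
    moreover have "(\<Sum>b\<in>B2. scale (c b) b) = (\<Sum>b\<in>B2. scale (c2 b) b)"
      by (rule sum.cong) (use disj in \<open>auto simp: c_def\<close>)
    ultimately have "v - (\<Sum>b\<in>B1 \<union> B2. scale (c b) b) \<in> T"
      using c2 unfolding split by (simp add: diff_diff_eq)
    then show "\<exists>c. v - (\<Sum>b\<in>B1 \<union> B2. scale (c b) b) \<in> T" by blast
  qed (use fin in_V in_K le in auto)
qed

lemma quot_dim_tower:
  assumes sub: "subspace T" "subspace K" "subspace V" and le: "T \<subseteq> K" "K \<subseteq> V"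
  shows "quot_dim scale V T = quot_dim scale V K + quot_dim scale K T"
proof (cases "\<exists>B. basis_mod scale V T B")
  case True
  then obtain B where B: "basis_mod scale V T B" by blast
  \<comment> \<open>Sets independent in \<open>V\<close> modulo \<open>K\<close>, and sets
    independent in \<open>K\<close> modulo \<open>T\<close>, are independent in \<open>V\<close>
    modulo \<open>T\<close>. One bound therefore yields finite bases of both smaller
    quotients.\<close>
  have bound: "indep_mod V T A \<Longrightarrow> card A \<le> card B" for A
    by (rule card_indep_mod_le[OF sub(1) B])
  obtain B1 where B1: "basis_mod scale V K B1"
    using basis_mod_exists[OF sub(2) bound[OF indep_mod_mono[OF _ order_refl le(1)]]] by blast
  obtain B2 where B2: "basis_mod scale K T B2"
    using basis_mod_exists[OF sub(1) bound[OF indep_mod_mono[OF _ le(2) order_refl]]] by blast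
  have "finite B1" "finite B2"
    using B1 B2 unfolding basis_mod_def by auto
  then show ?thesis
    using basis_mod_union[OF sub(1,2) le B1 B2] quot_dim_eqI[OF sub(1)]
      quot_dim_eqI[OF sub(2) B1] quot_dim_eqI[OF sub(1) B2]
    by (simp add: card_Un_disjoint)
next
  case False
  \<comment> \<open>Finite bases of both pieces would combine to one of the whole, so at least one
    summand is infinite as well.\<close>
  then have "(\<nexists>B. basis_mod scale V K B) \<or> (\<nexists>B. basis_mod scale K T B)"
    using basis_mod_union(2)[OF sub(1,2) le] by blast
  then show ?thesis using False by (auto simp: quot_dim_infinity)
qed

end

text \<open>\<open>f\<close> induces an isomorphism of the quotients: \<open>iff\<close> makes the
  induced map both well defined and injective, and \<open>onto\<close> asks for surjectivity only
  modulo \<open>T'\<close>. Hence \<open>f\<close> may be a mere section, or an inclusion of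
  representatives.\<close>

lemma quot_dim_iso:
  fixes s1 :: "'a::field \<Rightarrow> 'b::ab_group_add \<Rightarrow> 'b" and s2 :: "'a \<Rightarrow> 'c::ab_group_add \<Rightarrow> 'c"
  assumes vs: "vector_space s1" "vector_space s2"
    and sub: "module.subspace s1 V" "module.subspace s1 T" "module.subspace s2 T'"
    and add: "\<And>v w. v \<in> V \<Longrightarrow> w \<in> V \<Longrightarrow> f (v + w) = f v + f w"
    and scale: "\<And>c v. v \<in> V \<Longrightarrow> f (s1 c v) = s2 c (f v)"
    and into: "\<And>v. v \<in> V \<Longrightarrow> f v \<in> W"
    and iff: "\<And>v. v \<in> V \<Longrightarrow> f v \<in> T' \<longleftrightarrow> v \<in> T"
    and onto: "\<And>w. w \<in> W \<Longrightarrow> \<exists>v\<in>V. w - f v \<in> T'"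
  shows "quot_dim s1 V T = quot_dim s2 W T'"
proof -
  interpret vs1: vector_space_mod s1 by (simp add: vector_space_mod_def vs)
  interpret vs2: vector_space_mod s2 by (simp add: vector_space_mod_def vs)
  have zero: "f 0 = 0"
    using scale[of 0 0] vs1.subspace_0[OF sub(1)] by simp
  have sum: "(\<Sum>a\<in>A. s1 (c a) a) \<in> V \<and>
      f (\<Sum>a\<in>A. s1 (c a) a) = (\<Sum>a\<in>A. s2 (c a) (f a))" if "A \<subseteq> V" for A c
    using that
  proof (induction A rule: infinite_finite_induct)
    case (insert a A)
    then show ?case
      using vs1.subspace_add[OF sub(1)] vs1.subspace_scale[OF sub(1)] add scale by simp
  qed (use zero vs1.subspace_0[OF sub(1)] in auto)
  have indep: "inj_on f A \<and> vs2.indep_mod W T' (f ` A)" if A: "vs1.indep_mod V T A" for A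
  proof -
    have fin: "finite A" and in_V: "A \<subseteq> V" using A unfolding vs1.indep_mod_def by auto
    have ind: "c a = 0" if "(\<Sum>a\<in>A. s2 (c a) (f a)) \<in> T'" "a \<in> A" for c a
      using that sum[OF in_V, of c] iff vs1.indep_modD[OF A] by metis
    have inj: "inj_on f A"
    proof (rule inj_onI, rule ccontr)
      fix a a' assume a: "a \<in> A" "a' \<in> A" "f a = f a'" "a \<noteq> a'"
      have "(\<Sum>x\<in>A. s2 (if x = a then 1 else if x = a' then - 1 else 0) (f x))
          = (\<Sum>x\<in>A. (if x = a then f x else 0) - (if x = a' then f x else 0))"
        by (rule sum.cong) (use a in auto)
      also have "\<dots> = 0"
        using a fin by (simp add: sum_subtractf)
      finally have "(\<Sum>x\<in>A. s2 (if x = a then 1 else if x = a' then - 1 else 0) (f x)) \<in> T'"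
        using vs2.subspace_0[OF sub(3)] by simp
      from ind[OF this a(1)] show False by simp
    qed
    then show ?thesis
      using fin in_V into ind unfolding vs2.indep_mod_def
      by (auto simp: sum.reindex)
  qed
  show ?thesis
  proof (cases "\<exists>B. basis_mod s1 V T B")
    case True
    then obtain B where B: "basis_mod s1 V T B" by blast
    then have in_V: "B \<subseteq> V" and ind: "inj_on f B" "vs2.indep_mod W T' (f ` B)"
      using indep unfolding vs1.basis_mod_iff vs1.indep_mod_def by auto
    have "\<exists>c. w - (\<Sum>b\<in>f ` B. s2 (c b) b) \<in> T'" if "w \<in> W" for w
    proof -
      from onto[OF that] obtain v where v: "v \<in> V" "w - f v \<in> T'" by blast
      then obtain c where c: "v - (\<Sum>b\<in>B. s1 (c b) b) \<in> T"
        using B unfolding basis_mod_def by blast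
      have "f v = f (v - (\<Sum>b\<in>B. s1 (c b) b)) + (\<Sum>b\<in>B. s2 (c b) (f b))"
        using add[of "v - (\<Sum>b\<in>B. s1 (c b) b)" "\<Sum>b\<in>B. s1 (c b) b"] sum[OF in_V, of c] v
          vs1.subspace_diff[OF sub(1)] by simp
      then have "w - (\<Sum>b\<in>B. s2 (c b) (f b)) = (w - f v) + f (v - (\<Sum>b\<in>B. s1 (c b) b))"
        by (simp add: algebra_simps)
      moreover have "f (v - (\<Sum>b\<in>B. s1 (c b) b)) \<in> T'"
        using iff c v sum[OF in_V, of c] vs1.subspace_diff[OF sub(1)] by blast
      ultimately have "w - (\<Sum>b\<in>B. s2 (c b) (f b)) \<in> T'"
        using vs2.subspace_add[OF sub(3) v(2)] by (simp only:)
      \<comment> \<open>The coefficients are indexed by \<open>B\<close>; injectivity of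
        \<open>f\<close> allows them to be carried over to the image.\<close>
      then have "w - (\<Sum>b\<in>f ` B. s2 (c (inv_into B f b)) b) \<in> T'"
        using ind(1) by (simp add: sum.reindex)
      then show ?thesis by (rule exI[where x = "\<lambda>b. c (inv_into B f b)"])
    qed
    with ind(2) have "basis_mod s2 W T' (f ` B)" unfolding vs2.basis_mod_iff by blast
    then show ?thesis
      using vs1.quot_dim_eqI[OF sub(2) B] vs2.quot_dim_eqI[OF sub(3)]
      by (simp add: card_image[OF ind(1)])
  next
    case False
    \<comment> \<open>A finite basis of the target quotient would bound all independent sets of the
      source quotient, via their images, and so force a finite basis there.\<close>
    have "card A \<le> card B" if "basis_mod s2 W T' B" "vs1.indep_mod V T A" for A B
      using vs2.card_indep_mod_le[OF sub(3) that(1)] indep[OF that(2)]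
      by (metis card_image)
    with False have "\<nexists>B. basis_mod s2 W T' B"
      using vs1.basis_mod_exists[OF sub(2)] by blast
    with False show ?thesis by (simp add: vs1.quot_dim_infinity vs2.quot_dim_infinity)
  qed
qed


subsection \<open>Smooth germs\<close>

definition smooth_fun_on :: "('k::real_normed_field ^ 'i) set \<Rightarrow> ('k ^ 'i \<Rightarrow> 'k) \<Rightarrow> bool" where
  "smooth_fun_on U h \<longleftrightarrow> (\<forall>is. \<forall>x\<in>U.
     (iter_partial is h has_derivative
        (\<lambda>v. \<Sum>i\<in>UNIV. partial i (iter_partial is h) x * v $ i)) (at x))"

lemma germ_fun_iff: "germ_fun p h \<longleftrightarrow> (\<exists>U. open U \<and> p \<in> U \<and> smooth_fun_on U h)"
  unfolding germ_fun_def smooth_fun_on_def by blast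

lemma smooth_fun_on_subset: "smooth_fun_on U h \<Longrightarrow> V \<subseteq> U \<Longrightarrow> smooth_fun_on V h"
  unfolding smooth_fun_on_def by blast

lemma iter_partial_append: "iter_partial (is @ js) h = iter_partial is (iter_partial js h)"
  by (induction "is") auto

lemma smooth_fun_onD:
  assumes "smooth_fun_on U h" "x \<in> U"
  shows "(iter_partial is h has_derivative
    (\<lambda>v. \<Sum>i\<in>UNIV. partial i (iter_partial is h) x * v $ i)) (at x)"
  using assms unfolding smooth_fun_on_def by blast

lemma smooth_fun_on_partial:
  assumes "smooth_fun_on U h" shows "smooth_fun_on U (partial i h)"
  unfolding smooth_fun_on_def
proof (intro allI ballI)
  fix js x assume "x \<in> U"
  \<comment> \<open>The last entry of the list is the innermost derivative.\<close>
  from smooth_fun_onD[OF assms this, of "js @ [i]"]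
  show "(iter_partial js (partial i h) has_derivative
      (\<lambda>v. \<Sum>j\<in>UNIV. partial j (iter_partial js (partial i h)) x * v $ j)) (at x)"
    unfolding iter_partial_append iter_partial.simps .
qed

lemma smooth_fun_on_derivative:
  assumes "smooth_fun_on U h" "x \<in> U"
  shows "(h has_derivative (\<lambda>v. \<Sum>i\<in>UNIV. partial i h x * v $ i)) (at x)"
  using smooth_fun_onD[OF assms, of "[]"] unfolding iter_partial.simps .

lemma smooth_fun_on_continuous: "smooth_fun_on U h \<Longrightarrow> continuous_on U h"
  by (intro continuous_at_imp_continuous_on ballI)
    (rule has_derivative_continuous[OF smooth_fun_on_derivative])

lemma partial_eqI:
  fixes h :: "'k::real_normed_field ^ 'i \<Rightarrow> 'k"
  assumes "(h has_derivative (\<lambda>v. \<Sum>i\<in>UNIV. d i * v $ i)) (at x)"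
  shows "partial i h x = d i"
proof -
  have "frechet_derivative h (at x) = (\<lambda>v. \<Sum>i\<in>UNIV. d i * v $ i)"
    using assms by (rule frechet_derivative_at[symmetric])
  then show ?thesis
    unfolding partial_def by (simp add: axis_def if_distrib[of "(*) _"] cong: if_cong)
qed

text \<open>
  Coinduction: a family of functions whose first partial derivatives again belong to the family
  (on \<open>U\<close>) consists of smooth functions.
\<close>
lemma smooth_fun_on_coinduct:
  fixes h :: "'k::real_normed_field ^ 'i \<Rightarrow> 'k"
  assumes U: "open U" and h: "h \<in> S"
    and S: "\<And>s. s \<in> S \<Longrightarrow> \<exists>d. (\<forall>i. d i \<in> S) \<and>
      (\<forall>x\<in>U. (s has_derivative (\<lambda>v. \<Sum>i\<in>UNIV. d i x * v $ i)) (at x))"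
  shows "smooth_fun_on U h"
proof -
  \<comment> \<open>Outside \<open>U\<close> the iterated partials are values of
    \<open>frechet_derivative\<close> about which nothing is known, so agreement with a member of
    \<open>S\<close> is claimed on \<open>U\<close> only. Openness of \<open>U\<close> is enough to
    transport derivatives.\<close>
  have ex: "\<exists>s\<in>S. \<forall>x\<in>U. iter_partial is h x = s x" for "is"
  proof (induction "is")
    case Nil
    then show ?case using h by auto
  next
    case (Cons i "is")
    then obtain s where s: "s \<in> S" "\<forall>x\<in>U. iter_partial is h x = s x" by blast
    from S[OF s(1)] obtain d where d: "\<forall>i. d i \<in> S"
      "\<forall>x\<in>U. (s has_derivative (\<lambda>v. \<Sum>i\<in>UNIV. d i x * v $ i)) (at x)" by blast
    have "partial i (iter_partial is h) x = d i x" if "x \<in> U" for x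
      by (rule partial_eqI, rule has_derivative_transform_within_open[OF bspec[OF d(2) that] U that])
        (simp add: s(2))
    with d(1) show ?case by auto
  qed
  show ?thesis
    unfolding smooth_fun_on_def
  proof (intro allI ballI)
    fix "is" x assume x: "x \<in> U"
    obtain s where s: "s \<in> S" "\<forall>x\<in>U. iter_partial is h x = s x" using ex by blast
    from S[OF s(1)] obtain d where d:
      "\<forall>x\<in>U. (s has_derivative (\<lambda>v. \<Sum>i\<in>UNIV. d i x * v $ i)) (at x)" by blast
    have D: "(iter_partial is h has_derivative (\<lambda>v. \<Sum>i\<in>UNIV. d i x * v $ i)) (at x)"
      by (rule has_derivative_transform_within_open[OF bspec[OF d x] U x]) (simp add: s(2))
    then show "(iter_partial is h has_derivative
        (\<lambda>v. \<Sum>i\<in>UNIV. partial i (iter_partial is h) x * v $ i)) (at x)"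
      by (simp add: partial_eqI[OF D])
  qed
qed

lemma smooth_fun_on_const:
  assumes "open U" shows "smooth_fun_on U (\<lambda>x. c)"
proof (rule smooth_fun_on_coinduct[OF assms])
  show "(\<lambda>x. c) \<in> range (\<lambda>c x. c)" by blast
  fix s :: "'a ^ 'b \<Rightarrow> 'a" assume "s \<in> range (\<lambda>c x. c)"
  then show "\<exists>d. (\<forall>i. d i \<in> range (\<lambda>c x. c)) \<and>
      (\<forall>x\<in>U. (s has_derivative (\<lambda>v. \<Sum>i\<in>UNIV. d i x * v $ i)) (at x))"
    by (intro exI[of _ "\<lambda>i x. 0"] conjI) auto
qed

lemma smooth_fun_on_nth:
  assumes "open U" shows "smooth_fun_on U (\<lambda>x. x $ j)"
proof (rule smooth_fun_on_coinduct[OF assms])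
  show "(\<lambda>x. x $ j) \<in> insert (\<lambda>x. x $ j) {c. smooth_fun_on U c}" by blast
  fix s :: "'a ^ 'b \<Rightarrow> 'a" assume "s \<in> insert (\<lambda>x. x $ j) {c. smooth_fun_on U c}"
  then consider "s = (\<lambda>x. x $ j)" | "smooth_fun_on U s" by blast
  then show "\<exists>d. (\<forall>i. d i \<in> insert (\<lambda>x. x $ j) {c. smooth_fun_on U c}) \<and>
      (\<forall>x\<in>U. (s has_derivative (\<lambda>v. \<Sum>i\<in>UNIV. d i x * v $ i)) (at x))"
  proof cases
    case 1
    have "((\<lambda>x. x $ j) has_derivative (\<lambda>v. \<Sum>i\<in>UNIV. (if i = j then 1 else 0) * v $ i)) (at x)"
      for x :: "'a ^ 'b"
    proof -
      have "((\<lambda>x. x $ j) has_derivative (\<lambda>v. v $ j)) (at x)"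
        by (rule bounded_linear_imp_has_derivative) (rule bounded_linear_vec_nth)
      then show ?thesis
        by (simp add: if_distrib[of "\<lambda>c. c * _"] cong: if_cong)
    qed
    then show ?thesis
      using 1 smooth_fun_on_const[OF assms]
      by (intro exI[of _ "\<lambda>i x. if i = j then 1 else 0"]) auto
  next
    case 2
    then show ?thesis
      by (intro exI[of _ "\<lambda>i. partial i s"] conjI allI ballI)
        (auto intro: smooth_fun_on_partial smooth_fun_on_derivative)
  qed
qed

text \<open>\<open>\<Phi>\<close> is the sum of its components, each embedded along its coordinate
  axis, and these embeddings are bounded linear.\<close>

lemma has_derivative_vec:
  fixes \<Phi> :: "'v::real_normed_vector \<Rightarrow> 'k::real_normed_vector ^ 'j"
  assumes "\<And>j. ((\<lambda>x. \<Phi> x $ j) has_derivative D j) (at x)"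
  shows "(\<Phi> has_derivative (\<lambda>v. \<chi> j. D j v)) (at x)"
proof -
  have bl: "bounded_linear (axis j :: 'k \<Rightarrow> 'k ^ 'j)" for j
  proof (rule bounded_linear_intro)
    have "norm (axis j c :: 'k ^ 'j) = sqrt (\<Sum>i\<in>UNIV. if i = j then (norm c)\<^sup>2 else 0)" for c :: 'k
      unfolding norm_vec_def L2_set_def axis_def
      by (intro arg_cong[of _ _ sqrt] sum.cong) auto
    then show "norm (axis j c :: 'k ^ 'j) \<le> norm c * 1" for c :: 'k by simp
  qed (simp_all add: axis_def vec_eq_iff)
  have "((\<lambda>x. \<Sum>j\<in>UNIV. axis j (\<Phi> x $ j)) has_derivative
      (\<lambda>v. \<Sum>j\<in>UNIV. axis j (D j v))) (at x)"
    using assms by (intro has_derivative_sum bounded_linear.has_derivative[OF bl])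
  moreover have "(\<Sum>j\<in>UNIV. axis j (y j)) = (\<chi> j. y j)" for y :: "'j \<Rightarrow> 'k"
    by (simp add: vec_eq_iff axis_def)
  ultimately show ?thesis by simp
qed

text \<open>
  By the product and the chain rule this ring is closed under partial derivatives, so
  coinduction applies to it.
\<close>
inductive_set pullback_ring ::
  "('k::real_normed_field ^ 'i) set \<Rightarrow> ('k ^ 'j) set \<Rightarrow> ('k ^ 'i \<Rightarrow> 'k ^ 'j) \<Rightarrow> ('k ^ 'i \<Rightarrow> 'k) set"
  for U W \<Phi>
where
  base: "smooth_fun_on U h \<Longrightarrow> h \<in> pullback_ring U W \<Phi>"
| pullback: "smooth_fun_on W s \<Longrightarrow> (\<lambda>x. s (\<Phi> x)) \<in> pullback_ring U W \<Phi>"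
| add: "s \<in> pullback_ring U W \<Phi> \<Longrightarrow> t \<in> pullback_ring U W \<Phi> \<Longrightarrow>
    (\<lambda>x. s x + t x) \<in> pullback_ring U W \<Phi>"
| mult: "s \<in> pullback_ring U W \<Phi> \<Longrightarrow> t \<in> pullback_ring U W \<Phi> \<Longrightarrow>
    (\<lambda>x. s x * t x) \<in> pullback_ring U W \<Phi>"

lemma pullback_ring_sum:
  assumes "open U" "finite J" "\<And>j. j \<in> J \<Longrightarrow> s j \<in> pullback_ring U W \<Phi>"
  shows "(\<lambda>x. \<Sum>j\<in>J. s j x) \<in> pullback_ring U W \<Phi>"
  using assms(2,3)
  by (induction J rule: finite_induct)
    (auto intro: pullback_ring.intros smooth_fun_on_const[OF assms(1)])

lemma pullback_ring_smooth:
  fixes \<Phi> :: "'k::real_normed_field ^ 'i \<Rightarrow> 'k ^ 'j"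
  assumes U: "open U" and \<Phi>: "\<And>j. smooth_fun_on U (\<lambda>x. \<Phi> x $ j)" "\<Phi> ` U \<subseteq> W"
    and s: "s \<in> pullback_ring U W \<Phi>"
  shows "smooth_fun_on U s"
  using U s
proof (rule smooth_fun_on_coinduct)
  fix s assume "s \<in> pullback_ring U W \<Phi>"
  then show "\<exists>d. (\<forall>i. d i \<in> pullback_ring U W \<Phi>) \<and>
      (\<forall>x\<in>U. (s has_derivative (\<lambda>v. \<Sum>i\<in>UNIV. d i x * v $ i)) (at x))"
  proof induction
    case (base h)
    show ?case
    proof (intro exI[of _ "\<lambda>i. partial i h"] conjI allI ballI)
      show "partial i h \<in> pullback_ring U W \<Phi>" for i
        by (rule pullback_ring.base[OF smooth_fun_on_partial[OF base]])
    qed (rule smooth_fun_on_derivative[OF base])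
  next
    case (pullback s)
    let ?d = "\<lambda>i x. \<Sum>j\<in>UNIV. partial j s (\<Phi> x) * partial i (\<lambda>x. \<Phi> x $ j) x"
    show ?case
    proof (intro exI[of _ ?d] conjI allI ballI)
      show "?d i \<in> pullback_ring U W \<Phi>" for i
        by (intro pullback_ring_sum[OF U] finite pullback_ring.mult
            pullback_ring.pullback[OF smooth_fun_on_partial[OF pullback]]
            pullback_ring.base[OF smooth_fun_on_partial[OF \<Phi>(1)]])
    next
      fix x assume x: "x \<in> U"
      let ?D = "\<lambda>v. \<chi> j. \<Sum>i\<in>UNIV. partial i (\<lambda>x. \<Phi> x $ j) x * v $ i"
      have D: "(\<Phi> has_derivative ?D) (at x)"
        by (rule has_derivative_vec) (rule smooth_fun_on_derivative[OF \<Phi>(1) x])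
      have "\<Phi> x \<in> W" using \<Phi>(2) x by blast
      note has_derivative_compose[OF D smooth_fun_on_derivative[OF pullback this]]
      moreover have "(\<Sum>j\<in>UNIV. partial j s (\<Phi> x) * ?D v $ j) = (\<Sum>i\<in>UNIV. ?d i x * v $ i)"
        for v
        unfolding vec_lambda_beta sum_distrib_left sum_distrib_right
        by (subst sum.swap) (simp only: mult.assoc)
      ultimately show "((\<lambda>x. s (\<Phi> x)) has_derivative (\<lambda>v. \<Sum>i\<in>UNIV. ?d i x * v $ i)) (at x)"
        by simp
    qed
  next
    case (add s t)
    from add.IH(1) obtain d where d: "\<forall>i. d i \<in> pullback_ring U W \<Phi>"
      "\<forall>x\<in>U. (s has_derivative (\<lambda>v. \<Sum>i\<in>UNIV. d i x * v $ i)) (at x)" by (elim exE conjE)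
    from add.IH(2) obtain e where e: "\<forall>i. e i \<in> pullback_ring U W \<Phi>"
      "\<forall>x\<in>U. (t has_derivative (\<lambda>v. \<Sum>i\<in>UNIV. e i x * v $ i)) (at x)" by (elim exE conjE)
    show ?case
    proof (intro exI[of _ "\<lambda>i x. d i x + e i x"] conjI allI ballI)
      show "(\<lambda>x. d i x + e i x) \<in> pullback_ring U W \<Phi>" for i
        using d(1) e(1) by (intro pullback_ring.add) simp_all
      fix x assume "x \<in> U"
      from has_derivative_add[OF bspec[OF d(2) this] bspec[OF e(2) this]]
      show "((\<lambda>x. s x + t x) has_derivative (\<lambda>v. \<Sum>i\<in>UNIV. (d i x + e i x) * v $ i)) (at x)"
        by (simp only: distrib_right sum.distrib)
    qed
  next
    case (mult s t)
    from mult.IH(1) obtain d where d: "\<forall>i. d i \<in> pullback_ring U W \<Phi>"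
      "\<forall>x\<in>U. (s has_derivative (\<lambda>v. \<Sum>i\<in>UNIV. d i x * v $ i)) (at x)" by (elim exE conjE)
    from mult.IH(2) obtain e where e: "\<forall>i. e i \<in> pullback_ring U W \<Phi>"
      "\<forall>x\<in>U. (t has_derivative (\<lambda>v. \<Sum>i\<in>UNIV. e i x * v $ i)) (at x)" by (elim exE conjE)
    show ?case
    proof (intro exI[of _ "\<lambda>i x. s x * e i x + d i x * t x"] conjI allI ballI)
      show "(\<lambda>x. s x * e i x + d i x * t x) \<in> pullback_ring U W \<Phi>" for i
        using d(1) e(1) mult.hyps by (intro pullback_ring.add pullback_ring.mult) simp_all
      fix x assume "x \<in> U"
      note has_derivative_mult[OF bspec[OF d(2) this] bspec[OF e(2) this]]
      moreover have "s x * (\<Sum>i\<in>UNIV. e i x * v $ i) + (\<Sum>i\<in>UNIV. d i x * v $ i) * t x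
          = (\<Sum>i\<in>UNIV. (s x * e i x + d i x * t x) * v $ i)" for v
        unfolding sum_distrib_left sum_distrib_right sum.distrib[symmetric]
        by (rule sum.cong) (simp_all add: algebra_simps)
      ultimately show "((\<lambda>x. s x * t x) has_derivative
          (\<lambda>v. \<Sum>i\<in>UNIV. (s x * e i x + d i x * t x) * v $ i)) (at x)"
        by (simp only:)
    qed
  qed
qed

section \<open>Operations on smooth functions and germs\<close>

lemma smooth_fun_on_add:
  assumes "open U" "smooth_fun_on U h" "smooth_fun_on U g"
  shows "smooth_fun_on U (\<lambda>x. h x + g x)"
proof (rule pullback_ring_smooth[OF assms(1)])
  \<comment> \<open>The pullback ring is used along the identity map; its sums then give the
    claim.\<close>
  show "smooth_fun_on U (\<lambda>x. x $ j)" for j by (rule smooth_fun_on_nth[OF assms(1)])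
  show "(\<lambda>x. h x + g x) \<in> pullback_ring U U (\<lambda>x. x)"
    by (intro pullback_ring.add pullback_ring.base assms)
qed simp

lemma smooth_fun_on_mult:
  assumes "open U" "smooth_fun_on U h" "smooth_fun_on U g"
  shows "smooth_fun_on U (\<lambda>x. h x * g x)"
proof (rule pullback_ring_smooth[OF assms(1)])
  show "smooth_fun_on U (\<lambda>x. x $ j)" for j by (rule smooth_fun_on_nth[OF assms(1)])
  show "(\<lambda>x. h x * g x) \<in> pullback_ring U U (\<lambda>x. x)"
    by (intro pullback_ring.mult pullback_ring.base assms)
qed simp

lemma germ_fun_const: "germ_fun p (\<lambda>x. c)"
  unfolding germ_fun_iff by (intro exI[of _ UNIV]) (simp add: smooth_fun_on_const)

lemma germ_fun_nth: "germ_fun p (\<lambda>x. x $ i)"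
  unfolding germ_fun_iff by (intro exI[of _ UNIV]) (simp add: smooth_fun_on_nth)

lemma germ_fun_common:
  assumes "germ_fun p h" "germ_fun p g"
  obtains U where "open U" "p \<in> U" "smooth_fun_on U h" "smooth_fun_on U g"
proof -
  from assms obtain U V where "open U" "p \<in> U" "smooth_fun_on U h"
    "open V" "p \<in> V" "smooth_fun_on V g" unfolding germ_fun_iff by blast
  then show ?thesis
    by (intro that[of "U \<inter> V"]) (auto intro: smooth_fun_on_subset)
qed

lemma germ_fun_add: "germ_fun p h \<Longrightarrow> germ_fun p g \<Longrightarrow> germ_fun p (\<lambda>x. h x + g x)"
  unfolding germ_fun_iff[of p "\<lambda>x. h x + g x"]
  by (erule germ_fun_common, assumption) (intro exI conjI smooth_fun_on_add)

lemma germ_fun_mult: "germ_fun p h \<Longrightarrow> germ_fun p g \<Longrightarrow> germ_fun p (\<lambda>x. h x * g x)"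
  unfolding germ_fun_iff[of p "\<lambda>x. h x * g x"]
  by (erule germ_fun_common, assumption) (intro exI conjI smooth_fun_on_mult)

lemma germ_fun_minus: "germ_fun p h \<Longrightarrow> germ_fun p (\<lambda>x. - h x)"
  using germ_fun_mult[OF germ_fun_const[of p "- 1"], of h] by simp

lemma germ_fun_diff: "germ_fun p h \<Longrightarrow> germ_fun p g \<Longrightarrow> germ_fun p (\<lambda>x. h x - g x)"
  using germ_fun_add[OF _ germ_fun_minus, of p h g] by simp

text \<open>Each component has its own neighbourhood; there are finitely many components, so the
  intersection is still open.\<close>

lemma germ_map_open:
  fixes f :: "'k::real_normed_field ^ 'i \<Rightarrow> 'k ^ 'j"
  assumes "germ_map p f"
  obtains U where "open U" "p \<in> U" "\<And>j. smooth_fun_on U (\<lambda>x. f x $ j)"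
proof -
  have "\<forall>j. \<exists>U. open U \<and> p \<in> U \<and> smooth_fun_on U (\<lambda>x. f x $ j)"
    using assms unfolding germ_map_def germ_fun_iff by blast
  then obtain U where U: "\<And>j. open (U j) \<and> p \<in> U j \<and> smooth_fun_on (U j) (\<lambda>x. f x $ j)"
    by metis
  show ?thesis
    by (rule that[of "\<Inter>j. U j"])
      (use U in \<open>auto intro: smooth_fun_on_subset[where U = "U _"]\<close>)
qed

text \<open>The matrix form records that the derivative is \<open>'k\<close>-linear, which over the
  complex numbers is more than real linearity.\<close>

lemma germ_map_has_derivative:
  fixes f :: "'k::real_normed_field ^ 'i \<Rightarrow> 'k ^ 'j"
  assumes "germ_map p f"
  shows "\<forall>\<^sub>F x in nhds p.
    (f has_derivative (\<lambda>v. (\<chi> j i. partial i (\<lambda>x. f x $ j) x) *v v)) (at x)"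
proof -
  obtain U where U: "open U" "p \<in> U" "\<And>j. smooth_fun_on U (\<lambda>x. f x $ j)"
    by (rule germ_map_open[OF assms]) (rule that)
  have "(f has_derivative (\<lambda>v. (\<chi> j i. partial i (\<lambda>x. f x $ j) x) *v v)) (at x)"
    if "x \<in> U" for x
    using has_derivative_vec[OF smooth_fun_on_derivative[OF U(3) that]]
    by (simp add: matrix_vector_mult_def)
  then show ?thesis using U(1,2) unfolding eventually_nhds by blast
qed

lemma germ_map_continuous: "germ_map p f \<Longrightarrow> continuous (at p) f"
  using germ_map_has_derivative eventually_nhds_x_imp_x has_derivative_continuous by blast

lemma germ_fun_compose:
  fixes \<Phi> :: "'k::real_normed_field ^ 'i \<Rightarrow> 'k ^ 'j"
  assumes h: "germ_fun q h" and \<Phi>: "germ_map p \<Phi>" "\<Phi> p = q"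
  shows "germ_fun p (\<lambda>x. h (\<Phi> x))"
proof -
  obtain U where U: "open U" "p \<in> U" "\<And>j. smooth_fun_on U (\<lambda>x. \<Phi> x $ j)"
    by (rule germ_map_open[OF \<Phi>(1)]) (rule that)
  obtain W where W: "open W" "q \<in> W" "smooth_fun_on W h"
    using h unfolding germ_fun_iff by blast
  have "\<forall>\<^sub>F x in nhds p. \<Phi> x \<in> W"
    using germ_map_continuous[OF \<Phi>(1)] W(1,2) \<Phi>(2)
    by (auto simp: continuous_at_open eventually_nhds)
  then obtain V where V: "open V" "p \<in> V" "\<And>x. x \<in> V \<Longrightarrow> \<Phi> x \<in> W"
    unfolding eventually_nhds by blast
  have "smooth_fun_on (U \<inter> V) (\<lambda>x. h (\<Phi> x))"
  proof (rule pullback_ring_smooth)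
    show "smooth_fun_on (U \<inter> V) (\<lambda>x. \<Phi> x $ j)" for j
      using U(3) by (rule smooth_fun_on_subset) simp
    show "(\<lambda>x. h (\<Phi> x)) \<in> pullback_ring (U \<inter> V) W \<Phi>"
      using W(3) by (rule pullback_ring.pullback)
  qed (use U V in auto)
  then show ?thesis using U V unfolding germ_fun_iff by blast
qed

lemma germ_map_compose:
  assumes "germ_map q h" "germ_map p \<Phi>" "\<Phi> p = q"
  shows "germ_map p (\<lambda>x. h (\<Phi> x))"
  unfolding germ_map_def
  by (intro allI germ_fun_compose[OF _ assms(2,3)]) (use assms(1) in \<open>simp add: germ_map_def\<close>)

lemma germ_map_0: "germ_map p 0"
  unfolding germ_map_def zero_fun_def zero_index by (intro allI germ_fun_const)

lemma germ_map_add: "germ_map p f \<Longrightarrow> germ_map p g \<Longrightarrow> germ_map p (\<lambda>x. f x + g x)"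
  unfolding germ_map_def vector_add_component by (intro allI germ_fun_add) simp_all

lemma germ_map_diff: "germ_map p f \<Longrightarrow> germ_map p g \<Longrightarrow> germ_map p (\<lambda>x. f x - g x)"
  unfolding germ_map_def vector_minus_component by (intro allI germ_fun_diff) simp_all

lemma germ_map_scale: "germ_map p f \<Longrightarrow> germ_map p (\<lambda>x. c *s f x)"
  unfolding germ_map_def vector_smult_component
  by (intro allI germ_fun_mult germ_fun_const) simp


subsection \<open>Hadamard's lemma\<close>

text \<open>The straight path from the projection of \<open>x\<close> to the hyperplane where
  coordinate \<open>j\<close> vanishes, at t = 0, to \<open>x\<close> itself, at t = 1. The
  parameter is real over either field.\<close>

definition squeeze :: "'i \<Rightarrow> real \<Rightarrow> 'k::real_normed_vector ^ 'i \<Rightarrow> 'k ^ 'i" where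
  "squeeze j t x = (\<chi> i. if i = j then t *\<^sub>R x $ i else x $ i)"

lemma norm_squeeze_le:
  fixes x :: "'k::real_normed_vector ^ 'i"
  assumes "0 \<le> t" "t \<le> 1" shows "norm (squeeze j t x) \<le> norm x"
  unfolding norm_vec_def
proof (rule L2_set_mono)
  show "norm (squeeze j t x $ i) \<le> norm (x $ i)" for i
    using assms by (simp add: squeeze_def mult_left_le_one_le)
qed simp

lemma continuous_on_squeeze:
  fixes U :: "('k::real_normed_vector ^ 'i) set"
  shows "continuous_on (U \<times> T) (\<lambda>(x, t). squeeze j t x)"
proof -
  have "continuous_on (U \<times> T) (\<lambda>p. if i = j then snd p *\<^sub>R fst p $ i else fst p $ i)" for i
    by (cases "i = j") (auto intro!: continuous_intros)
  then show ?thesis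
    unfolding squeeze_def split_beta by (rule continuous_on_vec_lambda)
qed

lemma has_derivative_squeeze:
  fixes x :: "'k::real_normed_vector ^ 'i"
  shows "(squeeze j t has_derivative squeeze j t) (at x)"
proof -
  have "((\<lambda>x. squeeze j t x $ i) has_derivative (\<lambda>v. squeeze j t v $ i)) (at x)" for i
  proof -
    have "bounded_linear (\<lambda>v::'k ^ 'i. squeeze j t v $ i)"
      unfolding squeeze_def vec_lambda_beta
      by (cases "i = j") (auto intro!: bounded_linear_intros)
    then show ?thesis by (rule bounded_linear_imp_has_derivative)
  qed
  from has_derivative_vec[OF this] show ?thesis by (simp only: vec_nth_inverse)
qed

lemma has_derivative_squeeze_param:
  fixes x :: "'k::real_normed_vector ^ 'i"
  shows "((\<lambda>t. squeeze j t x) has_derivative (\<lambda>\<tau>. axis j (\<tau> *\<^sub>R x $ j))) (at t)"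
proof -
  have "((\<lambda>t. squeeze j t x $ i) has_derivative (\<lambda>\<tau>. if i = j then \<tau> *\<^sub>R x $ j else 0)) (at t)" for i
    unfolding squeeze_def vec_lambda_beta
    by (cases "i = j") (auto intro!: derivative_eq_intros)
  from has_derivative_vec[OF this] show ?thesis by (simp only: axis_def)
qed

text \<open>Differentiation under the integral sign. The chain rule brings out a further factor t
  exactly in direction \<open>j\<close>; the weight \<open>t ^ m\<close> is carried along so that
  partial derivatives of such integrals are again such integrals.\<close>

lemma has_derivative_integral_squeeze:
  fixes s :: "'k::{real_normed_field, euclidean_space} ^ 'i \<Rightarrow> 'k"
  assumes s: "smooth_fun_on (ball 0 e) s" and x: "x \<in> ball 0 e"
  shows "((\<lambda>x. integral {0..1} (\<lambda>t. t ^ m *\<^sub>R s (squeeze j t x))) has_derivative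
    (\<lambda>v. \<Sum>i\<in>UNIV. integral {0..1} (\<lambda>t. t ^ (if i = j then Suc m else m) *\<^sub>R
       partial i s (squeeze j t x)) * v $ i)) (at x)"
proof -
  let ?U = "ball 0 e :: ('k ^ 'i) set"
  define n where "n i = (if i = j then Suc m else m)" for i
  define a where "a i x t = t ^ n i *\<^sub>R partial i s (squeeze j t x)" for i x and t :: real
  define P :: "'i \<Rightarrow> ('k ^ 'i) \<Rightarrow>\<^sub>L 'k" where "P i = Blinfun (\<lambda>v. v $ i)" for i
  have P: "blinfun_apply (P i) v = v $ i" for i v
    unfolding P_def by (subst bounded_linear_Blinfun_apply) (auto intro: bounded_linear_vec_nth)
  \<comment> \<open>\<open>leibniz_rule\<close> takes the derivative as an operator-valued
    integrand. \<open>L i c\<close> is the functional that multiplies the \<open>i\<close>-th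
    coordinate by \<open>c\<close>; being bounded linear in \<open>c\<close>, it commutes with the
    integral.\<close>
  define L :: "'i \<Rightarrow> 'k \<Rightarrow> ('k ^ 'i) \<Rightarrow>\<^sub>L 'k" where "L i c = blinfun_mult_right c o\<^sub>L P i" for i c
  have L: "bounded_linear (L i)" for i
    unfolding L_def by (intro bounded_linear_intros)
  have L_app: "blinfun_apply (L i c) v = c * v $ i" for i c v
    by (simp add: L_def P)
  have in_U: "squeeze j t x \<in> ?U" if "x \<in> ?U" "t \<in> {0..1}" for x t
    using norm_squeeze_le[of t j x] that by auto
  have cont: "continuous_on (?U \<times> {0..1}) (\<lambda>p. snd p ^ k *\<^sub>R g (squeeze j (snd p) (fst p)))"
    if g: "smooth_fun_on ?U g" for g k
  proof -
    have "continuous_on (?U \<times> {0..1}) (\<lambda>p. g ((\<lambda>(x, t). squeeze j t x) p))"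
      by (rule continuous_on_compose2[OF smooth_fun_on_continuous[OF g] continuous_on_squeeze])
        (use in_U in auto)
    then show ?thesis
      unfolding split_beta by (intro continuous_intros)
  qed
  have cont1: "continuous_on {0..1} (\<lambda>t. t ^ k *\<^sub>R g (squeeze j t x))"
    if "smooth_fun_on ?U g" "x \<in> ?U" for g k x
  proof -
    have "continuous_on {0..1} (Pair x :: real \<Rightarrow> _)"
      by (intro continuous_intros)
    then have "continuous_on {0..1} (\<lambda>t. (\<lambda>p. snd p ^ k *\<^sub>R g (squeeze j (snd p) (fst p))) (Pair x t))"
      by (rule continuous_on_compose2[OF cont[OF that(1), of k]]) (use that(2) in auto)
    then show ?thesis by simp
  qed
  have "((\<lambda>x. integral (cbox 0 1) (\<lambda>t. t ^ m *\<^sub>R s (squeeze j t x))) has_derivative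
      blinfun_apply (integral (cbox 0 1) (\<lambda>t. \<Sum>i\<in>UNIV. L i (a i x t)))) (at x within ?U)"
  proof (rule leibniz_rule)
    fix x t assume x: "x \<in> ?U" and t: "t \<in> cbox 0 (1::real)"
    have "((\<lambda>x. s (squeeze j t x)) has_derivative
        (\<lambda>v. \<Sum>i\<in>UNIV. partial i s (squeeze j t x) * squeeze j t v $ i)) (at x)"
      using in_U[OF x] t
      by (intro has_derivative_compose[OF has_derivative_squeeze smooth_fun_on_derivative[OF s]]) simp
    from has_derivative_scaleR_right[OF this, of "t ^ m"]
    have "((\<lambda>x. t ^ m *\<^sub>R s (squeeze j t x)) has_derivative
        blinfun_apply (\<Sum>i\<in>UNIV. L i (a i x t))) (at x)"
    proof (rule has_derivative_eq_rhs)
      show "(\<lambda>v. t ^ m *\<^sub>R (\<Sum>i\<in>UNIV. partial i s (squeeze j t x) * squeeze j t v $ i))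
          = blinfun_apply (\<Sum>i\<in>UNIV. L i (a i x t))"
        unfolding fun_eq_iff blinfun.sum_left L_app scaleR_sum_right
        by (intro allI sum.cong) (auto simp: a_def n_def squeeze_def)
    qed
    then show "((\<lambda>x. t ^ m *\<^sub>R s (squeeze j t x)) has_derivative
        blinfun_apply (\<Sum>i\<in>UNIV. L i (a i x t))) (at x within ?U)"
      by (rule has_derivative_at_withinI)
  next
    show "(\<lambda>t. t ^ m *\<^sub>R s (squeeze j t x)) integrable_on cbox 0 1" if "x \<in> ?U" for x
      using cont1[OF s that] by (intro integrable_continuous) simp
  next
    have "continuous_on (?U \<times> {0..1}) (\<lambda>p. L i (a i (fst p) (snd p)))" for i
      unfolding a_def
      by (intro bounded_linear.continuous_on[OF L] cont smooth_fun_on_partial s)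
    then show "continuous_on (?U \<times> cbox 0 1) (\<lambda>(x, t). \<Sum>i\<in>UNIV. L i (a i x t))"
      unfolding split_beta by (intro continuous_on_sum) simp
  qed (use x in auto)
  moreover have "integral {0..1} (\<lambda>t. \<Sum>i\<in>UNIV. L i (a i x t)) = (\<Sum>i\<in>UNIV. L i (integral {0..1} (a i x)))"
  proof -
    have int: "a i x integrable_on {0..1}" for i
      unfolding a_def
      using cont1[OF smooth_fun_on_partial[OF s] x] by (rule integrable_continuous_interval)
    have "integral {0..1} (\<lambda>t. L i (a i x t)) = L i (integral {0..1} (a i x))"
      and "(\<lambda>t. L i (a i x t)) integrable_on {0..1}" for i
      using integral_linear[OF int L, of i i] integrable_linear[OF int L, of i i]
      by (simp_all add: o_def)
    then show ?thesis by (subst integral_sum) simp_all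
  qed
  moreover have "blinfun_apply (\<Sum>i\<in>UNIV. L i (c i)) = (\<lambda>v. \<Sum>i\<in>UNIV. c i * v $ i)" for c
    by (simp add: fun_eq_iff blinfun.sum_left L_app)
  ultimately show ?thesis
    unfolding a_def n_def by (simp add: at_within_open[OF x open_ball])
qed

lemma smooth_fun_on_integral_squeeze:
  fixes s :: "'k::{real_normed_field, euclidean_space} ^ 'i \<Rightarrow> 'k"
  assumes "smooth_fun_on (ball 0 e) s"
  shows "smooth_fun_on (ball 0 e) (\<lambda>x. integral {0..1} (\<lambda>t. t ^ m *\<^sub>R s (squeeze j t x)))"
proof -
  let ?I = "\<lambda>(m, s) x. integral {0..1} (\<lambda>t. t ^ m *\<^sub>R s (squeeze j t x)) :: 'k"
  \<comment> \<open>Exponent and integrand both change under differentiation, so the coinductive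
    family has to contain all such pairs.\<close>
  let ?S = "?I ` (UNIV \<times> {s. smooth_fun_on (ball 0 e) s})"
  have "?I (m, s) \<in> ?S" using assms by blast
  then have "smooth_fun_on (ball 0 e) (?I (m, s))"
  proof (rule smooth_fun_on_coinduct[OF open_ball])
    fix h assume "h \<in> ?S"
    then obtain m s where s: "smooth_fun_on (ball 0 e) s" and h: "h = ?I (m, s)" by auto
    show "\<exists>d. (\<forall>i. d i \<in> ?S) \<and>
        (\<forall>x\<in>ball 0 e. (h has_derivative (\<lambda>v. \<Sum>i\<in>UNIV. d i x * v $ i)) (at x))"
      unfolding h
    proof (intro exI[of _ "\<lambda>i. ?I (if i = j then Suc m else m, partial i s)"] conjI allI ballI)
      show "?I (if i = j then Suc m else m, partial i s) \<in> ?S" for i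
        using smooth_fun_on_partial[OF s] by blast
    qed (unfold prod.case, rule has_derivative_integral_squeeze[OF s])
  qed
  then show ?thesis by simp
qed

text \<open>The fundamental theorem of calculus along the path \<open>squeeze j t x\<close>: its
  velocity is \<open>x $ j\<close> in direction \<open>j\<close>, so this factor comes out of the
  integral of the partial derivative.\<close>

lemma germ_fun_hadamard:
  fixes h :: "'k::{real_normed_field, euclidean_space} ^ 'i \<Rightarrow> 'k"
  assumes h: "germ_fun 0 h" and 0: "\<forall>\<^sub>F x in nhds 0. x $ j = 0 \<longrightarrow> h x = 0"
  obtains k where "germ_fun 0 k" "\<forall>\<^sub>F x in nhds 0. h x = x $ j * k x"
proof -
  obtain U where U: "open U" "0 \<in> U" "smooth_fun_on U h"
    using h unfolding germ_fun_iff by blast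
  obtain V where V: "open V" "0 \<in> V" "\<And>x. x \<in> V \<Longrightarrow> x $ j = 0 \<Longrightarrow> h x = 0"
    using 0 unfolding eventually_nhds by blast
  obtain e where e: "e > 0" "ball 0 e \<subseteq> U \<inter> V"
    using open_contains_ball U V by (metis IntI open_Int)
  have s: "smooth_fun_on (ball 0 e) h"
    using U(3) by (rule smooth_fun_on_subset) (use e in auto)
  note s' = smooth_fun_on_partial[OF s, of j]
  \<comment> \<open>The factor \<open>t ^ 0\<close> only matches the weighted integrals whose
    smoothness is known.\<close>
  let ?k = "\<lambda>x. integral {0..1} (\<lambda>t. t ^ 0 *\<^sub>R partial j h (squeeze j t x))"
  have "h x = x $ j * ?k x" if x: "x \<in> ball 0 e" for x
  proof -
    let ?g = "\<lambda>t. partial j h (squeeze j t x)"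
    have in_U: "squeeze j t x \<in> ball 0 e" if "t \<in> {0..1}" for t
      using norm_squeeze_le[of t j x] that x by auto
    have "((\<lambda>t. h (squeeze j t x)) has_vector_derivative ?g t * x $ j) (at t within {0..1})"
      if "t \<in> {0..1}" for t
    proof -
      have "(\<Sum>i\<in>UNIV. partial i h (squeeze j t x) * axis j (\<tau> *\<^sub>R x $ j) $ i)
          = \<tau> *\<^sub>R (?g t * x $ j)" for \<tau>
        by (simp add: axis_def if_distrib[of "(*) _"] cong: if_cong)
      with has_derivative_compose[OF has_derivative_squeeze_param
          smooth_fun_on_derivative[OF s in_U[OF that]]]
      have "((\<lambda>t. h (squeeze j t x)) has_derivative (\<lambda>\<tau>. \<tau> *\<^sub>R (?g t * x $ j))) (at t)"
        by simp
      then show ?thesis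
        unfolding has_vector_derivative_def by (rule has_derivative_at_withinI)
    qed
    then have I: "((\<lambda>t. ?g t * x $ j) has_integral h (squeeze j 1 x) - h (squeeze j 0 x)) {0..1}"
      by (intro fundamental_theorem_of_calculus) simp_all
    have "squeeze j 0 x \<in> V" "squeeze j 0 x $ j = 0"
      using in_U[of 0] e(2) by (auto simp: squeeze_def)
    then have "h (squeeze j 0 x) = 0" by (rule V(3))
    moreover have "squeeze j 1 x = x" by (simp add: squeeze_def vec_eq_iff)
    ultimately have "((\<lambda>t. ?g t * x $ j) has_integral h x) {0..1}" using I by simp
    moreover have "continuous_on {0..1} ?g"
    proof -
      have "continuous_on {0..1} (\<lambda>t. (\<lambda>(x, t). squeeze j t x) (x, t))"
        by (rule continuous_on_compose2[OF continuous_on_squeeze[of UNIV UNIV]])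
          (auto intro!: continuous_intros)
      then show ?thesis
        by (intro continuous_on_compose2[OF smooth_fun_on_continuous[OF s']]) (use in_U in auto)
    qed
    then have "((\<lambda>t. ?g t * x $ j) has_integral integral {0..1} ?g * x $ j) {0..1}"
      by (intro has_integral_mult_left integrable_integral integrable_continuous_interval)
    ultimately have "h x = integral {0..1} ?g * x $ j" by (rule has_integral_unique)
    then show ?thesis by (simp add: mult.commute)
  qed
  then have "\<forall>\<^sub>F x in nhds 0. h x = x $ j * ?k x"
    using e(1) unfolding eventually_nhds by (intro exI[of _ "ball 0 e"]) simp
  moreover have "germ_fun 0 ?k"
    using smooth_fun_on_integral_squeeze[OF s', of 0] e(1) unfolding germ_fun_iff
    by (intro exI[of _ "ball 0 e"]) simp
  ultimately show ?thesis using that by blast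
qed


subsection \<open>Tangent spaces and liftable vector fields\<close>

lemma eventually_germ_map:
  fixes \<Phi> :: "'k::real_normed_field ^ 'i \<Rightarrow> 'k ^ 'j"
  assumes "germ_map p \<Phi>" "\<Phi> p = q" "\<forall>\<^sub>F y in nhds q. P y"
  shows "\<forall>\<^sub>F x in nhds p. P (\<Phi> x)"
proof -
  have "(\<Phi> \<longlongrightarrow> \<Phi> p) (nhds p)"
    using germ_map_continuous[OF assms(1)] by (simp add: isCont_def tendsto_at_iff_tendsto_nhds)
  with assms(2,3) show ?thesis by (auto elim: eventually_compose_filterlim)
qed

text \<open>\<open>frechet_derivative\<close> is a choice operator; near the base point its value is
  a genuine linear map. This linearity is what makes tangent spaces closed under linear
  combinations.\<close>

lemma germ_map_frechet_derivative:
  fixes f :: "'k::real_normed_field ^ 'i \<Rightarrow> 'k ^ 'j"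
  assumes "germ_map p f"
  shows "\<forall>\<^sub>F x in nhds p. \<exists>M. frechet_derivative f (at x) = (\<lambda>v. M *v v)"
  using germ_map_has_derivative[OF assms]
proof eventually_elim
  case (elim x)
  from frechet_derivative_at[OF this] show ?case by (intro exI) (rule sym)
qed

abbreviation (input) scale_fields ::
  "'k::real_normed_field \<Rightarrow> (nat \<Rightarrow> 'k ^ 'a \<Rightarrow> 'k ^ 'c) \<Rightarrow> nat \<Rightarrow> 'k ^ 'a \<Rightarrow> 'k ^ 'c"
  where "scale_fields \<equiv> \<lambda>c v i x. c *s v i x"

abbreviation (input) scale_fun :: "'k::real_normed_field \<Rightarrow> ('k ^ 'a \<Rightarrow> 'k) \<Rightarrow> 'k ^ 'a \<Rightarrow> 'k"
  where "scale_fun \<equiv> \<lambda>c h u. c * h u"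

lemma vector_space_scale_fields: "vector_space scale_fields"
  by unfold_locales (auto simp: fun_eq_iff vec_eq_iff algebra_simps)

lemma vector_space_scale_fun: "vector_space scale_fun"
  by unfold_locales (auto simp: fun_eq_iff algebra_simps)

lemmas subspace_fields_iff =
  module.subspace_def[OF vector_space_scale_fields[unfolded module_iff_vector_space[symmetric]]]
lemmas subspace_fun_iff =
  module.subspace_def[OF vector_space_scale_fun[unfolded module_iff_vector_space[symmetric]]]

text \<open>With the witnesses explicit, one relation serves both notions: for general
  \<open>v\<close> it expresses tangency, and for \<open>v = 0\<close> it says that \<eta> lifts,
  with -\<xi> as the lifting field.\<close>

definition tangent_via ::
  "('k::real_normed_field ^ 'a, 'k ^ 'b) multigerm \<Rightarrow> (nat \<Rightarrow> 'k ^ 'a \<Rightarrow> 'k ^ 'a) \<Rightarrow>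
    ('k ^ 'b \<Rightarrow> 'k ^ 'b) \<Rightarrow> (nat \<Rightarrow> 'k ^ 'a \<Rightarrow> 'k ^ 'b) \<Rightarrow> bool" where
  "tangent_via fs \<xi> \<eta> v \<longleftrightarrow> (\<forall>i<length fs. \<forall>\<^sub>F x in nhds (fst (fs ! i)).
     v i x = frechet_derivative (snd (fs ! i)) (at x) (\<xi> i x) + \<eta> (snd (fs ! i) x))"

lemma Ae_tangent_iff:
  "v \<in> Ae_tangent fs \<longleftrightarrow> v \<in> fields_along fs \<and>
     (\<exists>\<xi>\<in>fields_along fs. \<exists>\<eta>. germ_map 0 \<eta> \<and> tangent_via fs \<xi> \<eta> v)"
  unfolding Ae_tangent_def tangent_via_def split_beta by simp

lemma Ae_tangentI:
  "v \<in> fields_along fs \<Longrightarrow> \<xi> \<in> fields_along fs \<Longrightarrow> germ_map 0 \<eta> \<Longrightarrow> tangent_via fs \<xi> \<eta> v \<Longrightarrow>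
    v \<in> Ae_tangent fs"
  unfolding Ae_tangent_iff by blast

lemma tangent_via_cong:
  "tangent_via fs \<xi> \<eta> v \<Longrightarrow> (\<And>i. i < length fs \<Longrightarrow> \<xi> i = \<xi>' i) \<Longrightarrow>
     (\<And>i. i < length fs \<Longrightarrow> v i = v' i) \<Longrightarrow> tangent_via fs \<xi>' \<eta> v'"
  unfolding tangent_via_def by simp

lemma tangent_via_linear:
  assumes fs: "multigerm fs" and v: "tangent_via fs \<xi> \<eta> v" and v': "tangent_via fs \<xi>' \<eta>' v'"
  shows "tangent_via fs (\<lambda>i x. c *s \<xi> i x + d *s \<xi>' i x) (\<lambda>x. c *s \<eta> x + d *s \<eta>' x)
    (\<lambda>i x. c *s v i x + d *s v' i x)"
  unfolding tangent_via_def
proof (intro allI impI)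
  fix i assume i: "i < length fs"
  then have "germ_map (fst (fs ! i)) (snd (fs ! i))"
    using fs nth_mem unfolding multigerm_def by fastforce
  from germ_map_frechet_derivative[OF this] v[unfolded tangent_via_def, rule_format, OF i]
    v'[unfolded tangent_via_def, rule_format, OF i]
  show "\<forall>\<^sub>F x in nhds (fst (fs ! i)). c *s v i x + d *s v' i x =
      frechet_derivative (snd (fs ! i)) (at x) (c *s \<xi> i x + d *s \<xi>' i x) +
      (c *s \<eta> (snd (fs ! i) x) + d *s \<eta>' (snd (fs ! i) x))"
  proof eventually_elim
    case (elim x)
    then obtain M where "frechet_derivative (snd (fs ! i)) (at x) = (\<lambda>v. M *v v)" by blast
    with elim show ?case
      by (simp add: vec.add vec.scale matrix_vector_right_distrib algebra_simps)
  qed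
qed

lemma tangent_via_0:
  assumes "multigerm fs" shows "tangent_via fs 0 0 0"
  unfolding tangent_via_def
proof (intro allI impI)
  fix i assume i: "i < length fs"
  then have "germ_map (fst (fs ! i)) (snd (fs ! i))"
    using assms nth_mem unfolding multigerm_def by fastforce
  from germ_map_frechet_derivative[OF this]
  show "\<forall>\<^sub>F x in nhds (fst (fs ! i)). 0 i x =
      frechet_derivative (snd (fs ! i)) (at x) (0 i x) + 0 (snd (fs ! i) x)"
    by eventually_elim auto
qed

section \<open>Linear structure of tangent spaces and of liftable fields\<close>

lemma fields_along_linear:
  assumes "v \<in> fields_along fs" "w \<in> fields_along fs"
  shows "(\<lambda>i x. c *s v i x + d *s w i x) \<in> fields_along fs"
  unfolding fields_along_def mem_Collect_eq
  by (intro allI impI germ_map_add germ_map_scale) (use assms in \<open>simp_all add: fields_along_def\<close>)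

lemma zero_in_fields_along: "0 \<in> fields_along fs"
  unfolding fields_along_def by (simp add: germ_map_0)

lemma Ae_tangent_linear:
  assumes fs: "multigerm fs" and v: "v \<in> Ae_tangent fs" and w: "w \<in> Ae_tangent fs"
  shows "(\<lambda>i x. c *s v i x + d *s w i x) \<in> Ae_tangent fs"
proof -
  obtain \<xi> \<eta> where 1: "\<xi> \<in> fields_along fs" "germ_map 0 \<eta>" "tangent_via fs \<xi> \<eta> v"
    using v unfolding Ae_tangent_iff by blast
  obtain \<xi>' \<eta>' where 2: "\<xi>' \<in> fields_along fs" "germ_map 0 \<eta>'" "tangent_via fs \<xi>' \<eta>' w"
    using w unfolding Ae_tangent_iff by blast
  show ?thesis
    unfolding Ae_tangent_iff
  proof (intro conjI bexI exI)
    show "(\<lambda>i x. c *s v i x + d *s w i x) \<in> fields_along fs"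
      using v w by (intro fields_along_linear) (simp_all add: Ae_tangent_iff)
    show "(\<lambda>i x. c *s \<xi> i x + d *s \<xi>' i x) \<in> fields_along fs"
      by (rule fields_along_linear[OF 1(1) 2(1)])
    show "germ_map 0 (\<lambda>x. c *s \<eta> x + d *s \<eta>' x)"
      by (intro germ_map_add germ_map_scale 1 2)
  qed (rule tangent_via_linear[OF fs 1(3) 2(3)])
qed

lemma zero_in_Ae_tangent: "multigerm fs \<Longrightarrow> 0 \<in> Ae_tangent fs"
  by (rule Ae_tangentI[OF zero_in_fields_along zero_in_fields_along germ_map_0 tangent_via_0])

lemma subspace_fieldsI:
  assumes "0 \<in> S"
    and "\<And>c d v w. v \<in> S \<Longrightarrow> w \<in> S \<Longrightarrow> (\<lambda>i x. c *s v i x + d *s w i x) \<in> S"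
  shows "module.subspace scale_fields S"
  unfolding subspace_fields_iff
proof (intro conjI ballI allI)
  fix v w assume "v \<in> S" "w \<in> S"
  from assms(2)[OF this, of 1 1] show "v + w \<in> S" by (simp add: plus_fun_def)
next
  fix c v assume "v \<in> S"
  from assms(2)[OF this this, of c 0] show "scale_fields c v \<in> S" by simp
qed (rule assms(1))

lemma subspace_fields_along: "module.subspace scale_fields (fields_along fs)"
  by (rule subspace_fieldsI[OF zero_in_fields_along fields_along_linear])

lemma subspace_Ae_tangent: "multigerm fs \<Longrightarrow> module.subspace scale_fields (Ae_tangent fs)"
  by (rule subspace_fieldsI[OF zero_in_Ae_tangent Ae_tangent_linear])

text \<open>The two descriptions differ by the sign of \<xi>. The conversion is a linear combination
  with the trivial relation that represents \<eta> composed with each branch by \<eta> itself and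
  the zero source field.\<close>

lemma Lift_iff:
  assumes fs: "multigerm fs"
  shows "\<eta> \<in> Lift fs \<longleftrightarrow> germ_map 0 \<eta> \<and> (\<exists>\<xi>\<in>fields_along fs. tangent_via fs \<xi> \<eta> 0)"
proof -
  have Lift: "\<eta> \<in> Lift fs \<longleftrightarrow> germ_map 0 \<eta> \<and>
      (\<exists>\<xi>\<in>fields_along fs. tangent_via fs \<xi> 0 (\<lambda>i x. \<eta> (snd (fs ! i) x)))"
    unfolding Lift_def tangent_via_def split_beta by (simp add: eq_commute)
  have \<eta>: "tangent_via fs 0 \<eta> (\<lambda>i x. \<eta> (snd (fs ! i) x))"
    using tangent_via_0[OF fs] unfolding tangent_via_def by simp
  have "tangent_via fs (\<lambda>i x. - \<xi> i x) \<eta> 0"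
    if "tangent_via fs \<xi> 0 (\<lambda>i x. \<eta> (snd (fs ! i) x))" for \<xi>
    using tangent_via_linear[OF fs that \<eta>, of "- 1" 1] by (simp add: zero_fun_def)
  moreover have "tangent_via fs (\<lambda>i x. - \<xi> i x) 0 (\<lambda>i x. \<eta> (snd (fs ! i) x))"
    if "tangent_via fs \<xi> \<eta> 0" for \<xi>
    using tangent_via_linear[OF fs that \<eta>, of "- 1" 1] by (simp add: zero_fun_def)
  moreover have "(\<lambda>i x. - \<xi> i x) \<in> fields_along fs" if "\<xi> \<in> fields_along fs"
    for \<xi> :: "nat \<Rightarrow> 'a ^ 'b \<Rightarrow> 'a ^ 'b"
    using fields_along_linear[OF that that, of "- 1" 0] by simp
  ultimately show ?thesis unfolding Lift by blast
qed

lemma Lift_linear: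
  assumes fs: "multigerm fs" and \<eta>: "\<eta> \<in> Lift fs" and \<eta>': "\<eta>' \<in> Lift fs"
  shows "(\<lambda>x. c *s \<eta> x + d *s \<eta>' x) \<in> Lift fs"
proof -
  obtain \<xi> where 1: "germ_map 0 \<eta>" "\<xi> \<in> fields_along fs" "tangent_via fs \<xi> \<eta> 0"
    using \<eta> unfolding Lift_iff[OF fs] by blast
  obtain \<xi>' where 2: "germ_map 0 \<eta>'" "\<xi>' \<in> fields_along fs" "tangent_via fs \<xi>' \<eta>' 0"
    using \<eta>' unfolding Lift_iff[OF fs] by blast
  show ?thesis
    unfolding Lift_iff[OF fs]
  proof (intro conjI bexI)
    show "tangent_via fs (\<lambda>i x. c *s \<xi> i x + d *s \<xi>' i x) (\<lambda>x. c *s \<eta> x + d *s \<eta>' x) 0"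
      by (rule tangent_via_cong[OF tangent_via_linear[OF fs 1(3) 2(3)]]) auto
    show "(\<lambda>i x. c *s \<xi> i x + d *s \<xi>' i x) \<in> fields_along fs"
      by (rule fields_along_linear[OF 1(2) 2(2)])
    show "germ_map 0 (\<lambda>x. c *s \<eta> x + d *s \<eta>' x)"
      by (intro germ_map_add germ_map_scale 1 2)
  qed
qed

lemma zero_in_Lift: "multigerm fs \<Longrightarrow> 0 \<in> Lift fs"
  unfolding Lift_iff
  by (intro conjI bexI[of _ 0] tangent_via_0 zero_in_fields_along germ_map_0)

section \<open>Appending one branch to a multigerm\<close>

lemma fields_along_snoc:
  "v \<in> fields_along (fs @ [(p, g)]) \<longleftrightarrow> v \<in> fields_along fs \<and> germ_map p (v (length fs))"
  unfolding fields_along_def by (auto simp: less_Suc_eq nth_append)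

lemma tangent_via_snoc:
  "tangent_via (fs @ [(p, g)]) \<xi> \<eta> v \<longleftrightarrow> tangent_via fs \<xi> \<eta> v \<and>
     (\<forall>\<^sub>F x in nhds p. v (length fs) x = frechet_derivative g (at x) (\<xi> (length fs) x) + \<eta> (g x))"
  unfolding tangent_via_def by (auto simp: less_Suc_eq nth_append)

lemma Ae_tangent_snocD:
  assumes "v \<in> Ae_tangent (fs @ [(p, g)])"
  obtains \<xi> \<eta> \<zeta> where "\<xi> \<in> fields_along fs" "germ_map 0 \<eta>" "germ_map p \<zeta>" "tangent_via fs \<xi> \<eta> v"
    "\<forall>\<^sub>F x in nhds p. v (length fs) x = frechet_derivative g (at x) (\<zeta> x) + \<eta> (g x)"
proof -
  from assms obtain \<xi> \<eta> where "\<xi> \<in> fields_along (fs @ [(p, g)])" "germ_map 0 \<eta>"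
    "tangent_via (fs @ [(p, g)]) \<xi> \<eta> v" unfolding Ae_tangent_iff by blast
  then show thesis
    unfolding fields_along_snoc tangent_via_snoc by (elim conjE) (rule that)
qed

lemma Ae_tangent_snocI:
  assumes v: "v \<in> fields_along fs" "germ_map p (v (length fs))"
    and \<xi>: "\<xi> \<in> fields_along fs" and \<eta>: "germ_map 0 \<eta>" and \<zeta>: "germ_map p \<zeta>"
    and t: "tangent_via fs \<xi> \<eta> v"
      "\<forall>\<^sub>F x in nhds p. v (length fs) x = frechet_derivative g (at x) (\<zeta> x) + \<eta> (g x)"
  shows "v \<in> Ae_tangent (fs @ [(p, g)])"
proof (rule Ae_tangentI)
  show "v \<in> fields_along (fs @ [(p, g)])" using v by (simp add: fields_along_snoc)
  \<comment> \<open>The source fields on different branches are unrelated, so the entry for the new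
    branch can be overwritten without affecting the old ones.\<close>
  show "\<xi>(length fs := \<zeta>) \<in> fields_along (fs @ [(p, g)])"
    using \<xi> \<zeta> unfolding fields_along_def by (auto simp: less_Suc_eq nth_append)
  have "tangent_via fs (\<xi>(length fs := \<zeta>)) \<eta> v"
    by (rule tangent_via_cong[OF t(1)]) simp_all
  with t(2) show "tangent_via (fs @ [(p, g)]) (\<xi>(length fs := \<zeta>)) \<eta> v"
    by (simp add: tangent_via_snoc)
qed (rule \<eta>)


subsection \<open>Adding the branch \<open>fold2\<close>\<close>

lemma frechet_derivative_fold2:
  fixes w :: "'k::real_normed_field ^ ('m::finite + 2)"
  shows "frechet_derivative fold2 (at w) =
    (\<lambda>v. \<chi> i. if i = Inr 2 then 2 * w $ Inr 2 * v $ Inr 2 + v $ Inr 1 else v $ i)"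
proof -
  have nth: "((\<lambda>x. x $ i) has_derivative (\<lambda>v. v $ i)) (at w)" for i
    by (rule bounded_linear_imp_has_derivative) (rule bounded_linear_vec_nth)
  have "((\<lambda>x. fold2 x $ i) has_derivative
      (\<lambda>v. if i = Inr 2 then 2 * w $ Inr 2 * v $ Inr 2 + v $ Inr 1 else v $ i)) (at w)" for i
  proof (cases "i = Inr 2")
    case True
    have "((\<lambda>x. x $ Inr 2 * x $ Inr 2 + x $ Inr 1) has_derivative
        (\<lambda>v. (w $ Inr 2 * v $ Inr 2 + v $ Inr 2 * w $ Inr 2) + v $ Inr 1)) (at w)"
      by (intro has_derivative_add has_derivative_mult nth)
    with True show ?thesis
      by (simp add: fold2_def power2_eq_square algebra_simps)
  next
    case False
    with nth[of i] show ?thesis by (simp add: fold2_def)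
  qed
  from has_derivative_vec[OF this] show ?thesis by (rule frechet_derivative_at[symmetric])
qed

lemma germ_map_fold1: "germ_map p fold1"
  unfolding germ_map_def
proof
  fix i :: "'b + 2"
  show "germ_fun p (\<lambda>w. fold1 w $ i)"
    by (cases "i = Inr 2")
      (simp_all add: fold1_def power2_eq_square germ_fun_mult germ_fun_nth)
qed

lemma germ_map_fold2: "germ_map p fold2"
  unfolding germ_map_def
proof
  fix i :: "'b + 2"
  show "germ_fun p (\<lambda>w. fold2 w $ i)"
    by (cases "i = Inr 2")
      (simp_all add: fold2_def power2_eq_square germ_fun_add germ_fun_mult germ_fun_nth)
qed

lemma fold_0 [simp]: "fold1 0 = 0" "fold2 0 = 0"
  by (simp_all add: fold1_def fold2_def vec_eq_iff)

text \<open>Parametrises the critical set z = 0 of \<open>fold2\<close> by (x,y). Its image is the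
  discriminant of \<open>fold2\<close>, parametrised by \<open>diag\<close>, which is where the
  evaluation at (x,y,y) comes from.\<close>

definition fold_locus :: "'k::zero ^ ('m::finite + 1) \<Rightarrow> 'k ^ ('m + 2)" where
  "fold_locus u = (\<chi> i. case i of Inl a \<Rightarrow> u $ Inl a | Inr r \<Rightarrow> if r = 2 then 0 else u $ Inr 1)"

definition drop_z :: "'k ^ ('m::finite + 2) \<Rightarrow> 'k ^ ('m + 1)" where
  "drop_z w = (\<chi> i. case i of Inl a \<Rightarrow> w $ Inl a | Inr _ \<Rightarrow> w $ Inr 1)"

lemma fold2_fold_locus: "fold2 (fold_locus u) = diag u"
  by (auto simp: fold2_def fold_locus_def diag_def vec_eq_iff split: sum.split)

lemma fold_locus_nth_z [simp]: "fold_locus u $ Inr 2 = 0"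
  by (simp add: fold_locus_def)

lemma drop_z_fold_locus [simp]: "drop_z (fold_locus u) = u"
  by (auto simp: drop_z_def fold_locus_def vec_eq_iff split: sum.split)

lemma fold_locus_drop_z: "w $ Inr 2 = 0 \<Longrightarrow> fold_locus (drop_z w) = w"
proof -
  have "r = 1" if "r \<noteq> 2" for r :: 2 using exhaust_2[of r] that by blast
  then show "w $ Inr 2 = 0 \<Longrightarrow> fold_locus (drop_z w) = w"
    by (auto simp: drop_z_def fold_locus_def vec_eq_iff split: sum.split)
qed

lemma germ_map_fold_locus: "germ_map p fold_locus"
  unfolding germ_map_def
proof
  fix i :: "'b + 2"
  show "germ_fun p (\<lambda>w. fold_locus w $ i)"
  proof (cases i)
    case (Inr r)
    then show ?thesis
      by (cases "r = 2") (simp_all add: fold_locus_def germ_fun_const germ_fun_nth)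
  qed (simp add: fold_locus_def germ_fun_nth)
qed

lemma germ_map_drop_z: "germ_map p drop_z"
  unfolding germ_map_def
proof
  fix i :: "'b + 1"
  show "germ_fun p (\<lambda>w. drop_z w $ i)"
    by (cases i) (simp_all add: drop_z_def germ_fun_nth)
qed

lemma fold_locus_0 [simp]: "fold_locus 0 = 0" and drop_z_0 [simp]: "drop_z 0 = 0"
  by (auto simp: fold_locus_def drop_z_def vec_eq_iff split: sum.split)

lemma eventually_fold_locus:
  fixes P :: "'k::real_normed_field ^ ('m::finite + 2) \<Rightarrow> bool"
  shows "\<forall>\<^sub>F w in nhds 0. P w \<Longrightarrow> \<forall>\<^sub>F u in nhds 0. P (fold_locus u)"
  by (rule eventually_germ_map[OF germ_map_fold_locus fold_locus_0, where P = P])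

text \<open>On the hyperplane z = 0 the maps \<open>drop_z\<close> and \<open>fold_locus\<close> are
  mutually inverse, and both preserve the origin, so statements about germs on it can be checked in
  the coordinates (x,y).\<close>

lemma eventually_z_eq_0:
  fixes P :: "'k::real_normed_field ^ ('m::finite + 2) \<Rightarrow> bool"
  assumes "\<forall>\<^sub>F u in nhds 0. P (fold_locus u)"
  shows "\<forall>\<^sub>F w in nhds 0. w $ Inr 2 = 0 \<longrightarrow> P w"
  using eventually_germ_map[OF germ_map_drop_z drop_z_0 assms]
  by eventually_elim (auto simp: fold_locus_drop_z)

lemma fold2_tangent_fields:
  fixes w :: "'k::{real_normed_field, euclidean_space} ^ ('m::finite + 2) \<Rightarrow> 'k ^ ('m + 2)"
  assumes w: "germ_map 0 w" and eq: "\<forall>\<^sub>F u in nhds 0. w (fold_locus u) $ Inr 2 = w (fold_locus u) $ Inr 1"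
  obtains \<zeta> where "germ_map 0 \<zeta>" "\<forall>\<^sub>F x in nhds 0. w x = frechet_derivative fold2 (at x) (\<zeta> x)"
proof -
  have w_nth: "germ_fun 0 (\<lambda>x. w x $ i)" for i using w by (simp add: germ_map_def)
  have "germ_fun 0 (\<lambda>x. w x $ Inr 2 - w x $ Inr 1)"
    by (intro germ_fun_diff w_nth)
  moreover have "\<forall>\<^sub>F x in nhds 0. x $ Inr 2 = 0 \<longrightarrow> w x $ Inr 2 - w x $ Inr 1 = 0"
    by (rule eventually_z_eq_0) (use eq in simp)
  ultimately obtain k where k: "germ_fun 0 k"
    "\<forall>\<^sub>F x in nhds 0. w x $ Inr 2 - w x $ Inr 1 = x $ Inr 2 * k x"
    by (rule germ_fun_hadamard)
  \<comment> \<open>With all other components copied from \<open>w\<close>, the last one must solve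
    2 z \<zeta>_z + w_y = w_z, and w_z - w_y = z k by Hadamard's lemma.\<close>
  let ?\<zeta> = "\<lambda>x. \<chi> i. if i = Inr 2 then inverse 2 * k x else w x $ i"
  show ?thesis
  proof
    show "germ_map 0 ?\<zeta>"
      unfolding germ_map_def
    proof
      fix i :: "'m + 2"
      show "germ_fun 0 (\<lambda>x. ?\<zeta> x $ i)"
        using germ_fun_mult[OF germ_fun_const[of 0 "inverse 2"] k(1)]
        by (cases "i = Inr 2") (simp_all add: w_nth)
    qed
    show "\<forall>\<^sub>F x in nhds 0. w x = frechet_derivative fold2 (at x) (?\<zeta> x)"
      using k(2)
    proof eventually_elim
      case (elim x)
      then show ?case
        by (auto simp: frechet_derivative_fold2 vec_eq_iff algebra_simps)
    qed
  qed
qed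

text \<open>The equation is required only near 0, so this set contains every representative of the
  zero germ, as a denominator of a quotient of germs must.\<close>

definition diag_defect :: "('k::real_normed_field ^ ('m::finite + 2), 'k ^ ('m + 2)) multigerm \<Rightarrow>
    ('k ^ ('m + 1) \<Rightarrow> 'k) set" where
  "diag_defect G = {\<xi>. \<exists>\<eta>\<in>Lift G.
     \<forall>\<^sub>F u in nhds 0. \<xi> u = - (\<eta> (diag u) $ Inr 1) + \<eta> (diag u) $ Inr 2}"

lemma subspace_diag_defect:
  assumes G: "multigerm G" shows "module.subspace scale_fun (diag_defect G)"
proof -
  have lin: "(\<lambda>u. c * \<xi> u + d * \<xi>' u) \<in> diag_defect G"
    if 1: "\<xi> \<in> diag_defect G" and 2: "\<xi>' \<in> diag_defect G" for \<xi> \<xi>' c d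
  proof -
    obtain \<eta> where \<eta>: "\<eta> \<in> Lift G"
      "\<forall>\<^sub>F u in nhds 0. \<xi> u = - (\<eta> (diag u) $ Inr 1) + \<eta> (diag u) $ Inr 2"
      using 1 unfolding diag_defect_def by blast
    obtain \<eta>' where \<eta>': "\<eta>' \<in> Lift G"
      "\<forall>\<^sub>F u in nhds 0. \<xi>' u = - (\<eta>' (diag u) $ Inr 1) + \<eta>' (diag u) $ Inr 2"
      using 2 unfolding diag_defect_def by blast
    let ?\<eta> = "\<lambda>x. c *s \<eta> x + d *s \<eta>' x"
    have eq: "\<forall>\<^sub>F u in nhds 0. c * \<xi> u + d * \<xi>' u = - (?\<eta> (diag u) $ Inr 1) + ?\<eta> (diag u) $ Inr 2"
      using \<eta>(2) \<eta>'(2)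
    proof eventually_elim
      case (elim u)
      show ?case
        unfolding elim vector_add_component vector_smult_component by (simp add: algebra_simps)
    qed
    show ?thesis
      unfolding diag_defect_def mem_Collect_eq
      by (rule bexI[of _ ?\<eta>], rule eq, rule Lift_linear[OF G \<eta>(1) \<eta>'(1)])
  qed
  show ?thesis
    unfolding subspace_fun_iff
  proof (intro conjI ballI allI)
    show "0 \<in> diag_defect G"
      unfolding diag_defect_def using zero_in_Lift[OF G]
      by (intro CollectI bexI[of _ 0]) simp_all
    fix \<xi> \<xi>' assume "\<xi> \<in> diag_defect G" "\<xi>' \<in> diag_defect G"
    from lin[OF this, of 1 1] show "\<xi> + \<xi>' \<in> diag_defect G" by (simp add: plus_fun_def)
  next
    fix c \<xi> assume "\<xi> \<in> diag_defect G"
    from lin[OF this this, of c 0] show "scale_fun c \<xi> \<in> diag_defect G" by simp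
  qed
qed

lemma subspace_germ_fun: "module.subspace scale_fun {h. germ_fun p h}"
  unfolding subspace_fun_iff
  by (auto simp: plus_fun_def zero_fun_def germ_fun_const germ_fun_add germ_fun_mult)

lemma Ae_cod_snoc_fold2:
  fixes G :: "('k::{real_normed_field, euclidean_space} ^ ('m::finite + 2), 'k ^ ('m + 2)) multigerm"
  assumes G: "multigerm G"
  shows "Ae_cod (G @ [(0, fold2)]) = Ae_cod G + quot_dim scale_fun {h. germ_fun 0 h} (diag_defect G)"
proof -
  interpret fields: vector_space_mod "scale_fields :: 'k \<Rightarrow> (nat \<Rightarrow> 'k ^ ('m + 2) \<Rightarrow> 'k ^ ('m + 2)) \<Rightarrow> _"
    by (simp add: vector_space_mod_def vector_space_scale_fields)
  let ?N = "length G" and ?G' = "G @ [(0, fold2)]"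
  let ?V = "fields_along ?G' :: (nat \<Rightarrow> 'k ^ ('m + 2) \<Rightarrow> 'k ^ ('m + 2)) set"
  \<comment> \<open>The kernel of forgetting the new branch, lifted to representatives: tangent on
    \<open>G\<close>, arbitrary smooth on \<open>fold2\<close>.\<close>
  let ?K = "?V \<inter> Ae_tangent G"
  have G': "multigerm ?G'"
    using G germ_map_fold2 by (auto simp: multigerm_def)
  have sub_K: "fields.subspace ?K"
    using subspace_fields_along subspace_Ae_tangent[OF G] by (rule fields.subspace_inter)
  have tower: "Ae_cod ?G' = quot_dim scale_fields ?V ?K + quot_dim scale_fields ?K (Ae_tangent ?G')"
    unfolding Ae_cod_def
  proof (rule fields.quot_dim_tower[OF subspace_Ae_tangent[OF G'] sub_K subspace_fields_along])
    show "Ae_tangent ?G' \<subseteq> ?K"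
    proof
      fix v assume v: "v \<in> Ae_tangent ?G'"
      from v have "v \<in> ?V" unfolding Ae_tangent_iff by simp
      then have "v \<in> fields_along G" by (simp add: fields_along_snoc)
      obtain \<xi> \<eta> where "\<xi> \<in> fields_along G" "germ_map 0 \<eta>" "tangent_via G \<xi> \<eta> v"
        by (rule Ae_tangent_snocD[OF v]) (rule that)
      with \<open>v \<in> fields_along G\<close> have "v \<in> Ae_tangent G" by (rule Ae_tangentI)
      with \<open>v \<in> ?V\<close> show "v \<in> ?K" by simp
    qed
  qed simp
  have restrict: "quot_dim scale_fields ?V ?K = Ae_cod G"
    unfolding Ae_cod_def
  proof (rule quot_dim_iso[where f = "\<lambda>v. v", OF vector_space_scale_fields vector_space_scale_fields
        subspace_fields_along sub_K subspace_Ae_tangent[OF G]])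
    show "\<And>v. v \<in> ?V \<Longrightarrow> v \<in> fields_along G" by (simp add: fields_along_snoc)
  next
    fix w :: "nat \<Rightarrow> 'k ^ ('m + 2) \<Rightarrow> 'k ^ ('m + 2)" assume w: "w \<in> fields_along G"
    \<comment> \<open>An element of \<open>fields_along G\<close> may carry any function, even a
      non-smooth one, at index \<open>?N\<close>. Replacing it by 0 gives a field on the larger
      multigerm without changing the branches of \<open>G\<close>.\<close>
    let ?v = "w(?N := 0)"
    have "?v \<in> fields_along G" using w unfolding fields_along_def by simp
    then have "?v \<in> ?V" unfolding fields_along_snoc by (simp add: germ_map_0)
    moreover have "w - ?v \<in> Ae_tangent G"
    proof (rule Ae_tangentI[OF _ zero_in_fields_along germ_map_0])
      show "w - ?v \<in> fields_along G"
        using fields_along_linear[OF w \<open>?v \<in> fields_along G\<close>, of 1 "- 1"]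
        by (simp add: fun_diff_def)
      show "tangent_via G 0 0 (w - ?v)"
        by (rule tangent_via_cong[OF tangent_via_0[OF G]]) simp_all
    qed
    ultimately show "\<exists>v\<in>?V. w - v \<in> Ae_tangent G" by blast
  qed simp_all
  define \<sigma> :: "('k ^ ('m + 1) \<Rightarrow> 'k) \<Rightarrow> nat \<Rightarrow> 'k ^ ('m + 2) \<Rightarrow> 'k ^ ('m + 2)"
    where "\<sigma> h = (\<lambda>i x. if i = ?N then axis (Inr 2) (h (drop_z x)) else 0)" for h
  have \<sigma>_less: "\<sigma> h i = 0" if "i < ?N" for h i using that by (auto simp: \<sigma>_def)
  have \<sigma>_N: "\<sigma> h ?N x = axis (Inr 2) (h (drop_z x))" for h x by (simp add: \<sigma>_def)
  have \<sigma>_fields: "\<sigma> h \<in> fields_along G" for h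
    unfolding fields_along_def by (auto simp: \<sigma>_less germ_map_0)
  have germ_\<sigma>: "germ_map 0 (\<sigma> h ?N)" if "germ_fun 0 h" for h
    unfolding germ_map_def
  proof
    fix i
    show "germ_fun 0 (\<lambda>x. \<sigma> h ?N x $ i)"
      using germ_fun_compose[OF that germ_map_drop_z drop_z_0]
      by (cases "i = Inr 2") (simp_all add: \<sigma>_N axis_def germ_fun_const)
  qed
  have kernel: "quot_dim scale_fun {h. germ_fun 0 h} (diag_defect G)
      = quot_dim scale_fields ?K (Ae_tangent ?G')"
  proof (rule quot_dim_iso[where f = \<sigma>, OF vector_space_scale_fun vector_space_scale_fields
        subspace_germ_fun subspace_diag_defect[OF G] subspace_Ae_tangent[OF G']])
    show "\<sigma> (h + h') = \<sigma> h + \<sigma> h'" for h h'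
      by (auto simp: \<sigma>_def fun_eq_iff axis_def vec_eq_iff)
    show "\<sigma> (scale_fun c h) = scale_fields c (\<sigma> h)" for c h
      by (auto simp: \<sigma>_def fun_eq_iff axis_def vec_eq_iff)
  next
    fix h :: "'k ^ ('m + 1) \<Rightarrow> 'k" assume "h \<in> {h. germ_fun 0 h}"
    then have h: "germ_fun 0 h" by simp
    have "\<sigma> h \<in> Ae_tangent G"
    proof (rule Ae_tangentI[OF \<sigma>_fields zero_in_fields_along germ_map_0])
      show "tangent_via G 0 0 (\<sigma> h)"
        by (rule tangent_via_cong[OF tangent_via_0[OF G]]) (simp_all add: \<sigma>_less)
    qed
    then show "\<sigma> h \<in> ?K" using germ_\<sigma>[OF h] \<sigma>_fields by (simp add: fields_along_snoc)
    show "\<sigma> h \<in> Ae_tangent ?G' \<longleftrightarrow> h \<in> diag_defect G"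
    proof
      assume "\<sigma> h \<in> Ae_tangent ?G'"
      then obtain \<xi> \<eta> \<zeta> where \<xi>: "\<xi> \<in> fields_along G" and \<eta>: "germ_map 0 \<eta>"
        and t: "tangent_via G \<xi> \<eta> (\<sigma> h)"
        and N: "\<forall>\<^sub>F x in nhds 0. \<sigma> h ?N x = frechet_derivative fold2 (at x) (\<zeta> x) + \<eta> (fold2 x)"
        by (rule Ae_tangent_snocD)
      \<comment> \<open>\<open>\<sigma> h\<close> vanishes on the branches of \<open>G\<close>, so
        the witness \<eta> is forced to be liftable.\<close>
      have "tangent_via G \<xi> \<eta> 0"
        by (rule tangent_via_cong[OF t]) (simp_all add: \<sigma>_less)
      with \<xi> \<eta> have "\<eta> \<in> Lift G" unfolding Lift_iff[OF G] by blast
      moreover have "\<forall>\<^sub>F u in nhds 0. h u = - (\<eta> (diag u) $ Inr 1) + \<eta> (diag u) $ Inr 2"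
        using eventually_fold_locus[OF N]
      proof eventually_elim
        case (elim u)
        let ?z = "\<zeta> (fold_locus u)"
        \<comment> \<open>On z = 0 the term 2 z \<zeta>_z disappears. Component y reads 0 =
          \<zeta>_y + \<eta>_y and component z reads h = \<zeta>_y + \<eta>_z; eliminating \<zeta>_y
          leaves the defect.\<close>
        from elim have "axis (Inr 2) (h u) $ i = (if i = Inr 2 then ?z $ Inr 1 else ?z $ i) + \<eta> (diag u) $ i" for i
          by (simp add: \<sigma>_N fold2_fold_locus frechet_derivative_fold2)
        from this[of "Inr 1"] this[of "Inr 2"] show ?case
          by (simp add: axis_def algebra_simps)
      qed
      ultimately show "h \<in> diag_defect G" unfolding diag_defect_def by blast
    next
      assume "h \<in> diag_defect G"
      then obtain \<eta> where "\<eta> \<in> Lift G"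
        and eq: "\<forall>\<^sub>F u in nhds 0. h u = - (\<eta> (diag u) $ Inr 1) + \<eta> (diag u) $ Inr 2"
        unfolding diag_defect_def by blast
      then obtain \<xi> where \<xi>: "\<xi> \<in> fields_along G" and \<eta>: "germ_map 0 \<eta>" and t: "tangent_via G \<xi> \<eta> 0"
        unfolding Lift_iff[OF G] by blast
      \<comment> \<open>What the source field on the new branch has to absorb. The defect equation
        for h says precisely that its y- and z-components agree on the critical set.\<close>
      let ?w = "\<lambda>x. \<sigma> h ?N x - \<eta> (fold2 x)"
      have "germ_map 0 ?w"
        by (intro germ_map_diff germ_\<sigma> h germ_map_compose[OF \<eta> germ_map_fold2]) simp
      moreover have "\<forall>\<^sub>F u in nhds 0. ?w (fold_locus u) $ Inr 2 = ?w (fold_locus u) $ Inr 1"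
        using eq by eventually_elim (simp add: \<sigma>_N fold2_fold_locus axis_def)
      ultimately obtain \<zeta> where \<zeta>: "germ_map 0 \<zeta>"
        "\<forall>\<^sub>F x in nhds 0. ?w x = frechet_derivative fold2 (at x) (\<zeta> x)"
        by (rule fold2_tangent_fields)
      show "\<sigma> h \<in> Ae_tangent ?G'"
      proof (rule Ae_tangent_snocI[OF \<sigma>_fields germ_\<sigma>[OF h] \<xi> \<eta> \<zeta>(1)])
        show "\<forall>\<^sub>F x in nhds 0. \<sigma> h ?N x = frechet_derivative fold2 (at x) (\<zeta> x) + \<eta> (fold2 x)"
          using \<zeta>(2) by eventually_elim (simp add: algebra_simps)
        show "tangent_via G \<xi> \<eta> (\<sigma> h)"
          by (rule tangent_via_cong[OF t]) (simp_all add: \<sigma>_less)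
      qed
    qed
  next
    fix v assume v: "v \<in> ?K"
    then have "v \<in> Ae_tangent G" by simp
    then obtain \<xi> \<eta> where \<xi>: "\<xi> \<in> fields_along G" and \<eta>: "germ_map 0 \<eta>" and t: "tangent_via G \<xi> \<eta> v"
      unfolding Ae_tangent_iff by (elim conjE bexE exE) (rule that)
    have vN: "germ_map 0 (v ?N)" and vG: "v \<in> fields_along G" using v by (simp_all add: fields_along_snoc)
    \<comment> \<open>Fix some \<eta> that realises \<open>v\<close> on \<open>G\<close>. The
      residue \<open>r\<close> on the new branch has a defect \<open>h\<close> along the critical
      set; \<open>\<sigma> h\<close> has the same defect, so the difference is in the image of the
      derivative of \<open>fold2\<close>.\<close>
    define r where "r x = v ?N x - \<eta> (fold2 x)" for x
    define h where "h u = r (fold_locus u) $ Inr 2 - r (fold_locus u) $ Inr 1" for u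
    have r: "germ_map 0 r"
      unfolding r_def by (intro germ_map_diff vN germ_map_compose[OF \<eta> germ_map_fold2]) simp
    then have "germ_map 0 (\<lambda>u. r (fold_locus u))"
      by (rule germ_map_compose[OF _ germ_map_fold_locus fold_locus_0])
    then have h: "germ_fun 0 h"
      unfolding h_def by (intro germ_fun_diff) (simp_all add: germ_map_def)
    let ?w = "\<lambda>x. r x - \<sigma> h ?N x"
    have "germ_map 0 ?w"
      by (intro germ_map_diff r germ_\<sigma> h)
    moreover have "\<forall>\<^sub>F u in nhds 0. ?w (fold_locus u) $ Inr 2 = ?w (fold_locus u) $ Inr 1"
      by (simp add: \<sigma>_N h_def axis_def)
    ultimately obtain \<zeta> where \<zeta>: "germ_map 0 \<zeta>"
      "\<forall>\<^sub>F x in nhds 0. ?w x = frechet_derivative fold2 (at x) (\<zeta> x)"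
      by (rule fold2_tangent_fields)
    have "v - \<sigma> h \<in> Ae_tangent ?G'"
    proof (rule Ae_tangent_snocI[OF _ _ \<xi> \<eta> \<zeta>(1)])
      show "\<forall>\<^sub>F x in nhds 0. (v - \<sigma> h) ?N x = frechet_derivative fold2 (at x) (\<zeta> x) + \<eta> (fold2 x)"
        using \<zeta>(2) by eventually_elim (simp add: r_def algebra_simps)
      show "tangent_via G \<xi> \<eta> (v - \<sigma> h)"
        by (rule tangent_via_cong[OF t]) (simp_all add: \<sigma>_less)
      show "v - \<sigma> h \<in> fields_along G"
        using fields_along_linear[OF vG \<sigma>_fields, of 1 "- 1" h] by (simp add: fun_diff_def)
      show "germ_map 0 ((v - \<sigma> h) ?N)"
        using germ_map_diff[OF vN germ_\<sigma>[OF h]] by (simp add: fun_diff_def)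
    qed
    with h show "\<exists>h\<in>{h. germ_fun 0 h}. v - \<sigma> h \<in> Ae_tangent ?G'" by blast
  qed
  show ?thesis unfolding tower restrict kernel ..
qed

theorem theorem4p17:
  fixes f :: "('k::{real_normed_field, euclidean_space} ^ 'm, 'k ^ 'm) multigerm"
    and F :: "('k ^ ('m + 2), 'k ^ ('m + 2)) multigerm"
  assumes "multigerm f" and "distinct (map fst f)"
    and "finitely_determined f" and "minimal_corank f"
    and "is_unfolding f F" and "stable_multigerm F"
  shows "Ae_cod (F @ [(0, fold1), (0, fold2)]) =
    Ae_cod (F @ [(0, fold1)]) +
    quot_dim (\<lambda>c h u. c * h u)
      {h :: 'k ^ ('m + 1) \<Rightarrow> 'k. germ_fun 0 h}
      {\<xi>. \<exists>\<eta>\<in>Lift (F @ [(0, fold1)]).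
         \<forall>\<^sub>F u in nhds 0. \<xi> u = - (\<eta> (diag u) $ Inr 1) + \<eta> (diag u) $ Inr 2}"
proof -
  \<comment> \<open>The branches of \<open>F\<close> together with \<open>fold1\<close> take the
    role of \<open>G\<close>; \<open>is_unfolding\<close> contains that \<open>F\<close> is a
    multigerm.\<close>
  have "multigerm (F @ [(0, fold1)])"
    using assms(5) germ_map_fold1 by (auto simp: is_unfolding_def multigerm_def)
  from Ae_cod_snoc_fold2[OF this] show ?thesis
    unfolding diag_defect_def by simp
qed

end
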